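(* Let $T=([n],E)$ be a tree with distance matrix $D=(d(i,j))_{1\le i,j\le n}$, and let $S\subseteq[n]$ be a subset of cardinality $m\ge 2$. Let $D[S]=(d(i,j))_{i,j\in S}$ be the principal submatrix of $D$ indexed by $S$. Then $$\det D[S]=(-1)^{m-1}2^{m-2}\left((m-1)\,\#\mathcal F_1(T;S)-\sum_{F\in\mathcal F_2(T;S)}\big(\delta(F_* )-1\big)\big(\delta(F_* )-4\big)\right).$$
   Context: $[n]=\{1,\dots,n\}$; $d(i,j)$ is the number of edges of the unique path from $i$ to $j$ in $T$. A spanning forest of $T$ is an (acyclic) subgraph of $T$ containing every vertex of $T$; isolated vertices count as connected components. $\mathcal F_1(T;S)$ is the set of $S$-rooted spanning forests of $T$: spanning forests with exactly $m=\#S$ connected components, each containing exactly one vertex of $S$. $\mathcal F_2(T;S)$ is the set of $(S,* )$-rooted spanning forests of $T$: spanning forests $F$ with exactly $m+1$ connected components, exactly one of which contains no vertex of $S$ (so each other component contains exactly one vertex of $S$). The component without vertices of $S$ is denoted $F_*$ and called the floating component of $F$. The boundary degree $\delta(F_* )$ is the number of vertices of $T$ that do not belong to $F_*$ but are adjacent in $T$ to some vertex of $F_*$. *)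

theory Defs
  imports "Jordan_Normal_Form.Determinant" "Jordan_Normal_Form.DL_Submatrix"
begin

text \<open>
  Undirected graphs, with edges given as two-element sets of vertices.  The directed notions of
  \<open>forest\<close> and \<open>tree\<close> in the AFP entry \<open>Graph_Theory\<close> do not serve here: in a symmetric digraph
  every edge, traversed back and forth, is a directed cycle.
\<close>

datatype 'a graph = Graph (verts: "'a set") (edges: "'a set set")

definition simple_graph :: "'a graph \<Rightarrow> bool" where
  "simple_graph G \<longleftrightarrow> finite (verts G) \<and> (\<forall>e\<in>edges G. e \<subseteq> verts G \<and> card e = 2)"

definition is_path :: "'a graph \<Rightarrow> 'a \<Rightarrow> 'a list \<Rightarrow> 'a \<Rightarrow> bool" where
  "is_path G u p v \<longleftrightarrow>
     p \<noteq> [] \<and> hd p = u \<and> last p = v \<and> set p \<subseteq> verts G \<and> distinct p \<and>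
     successively (\<lambda>x y. {x, y} \<in> edges G) p"

text \<open>A cycle is listed without repeating its first vertex at the end.\<close>

definition is_cycle :: "'a graph \<Rightarrow> 'a list \<Rightarrow> bool" where
  "is_cycle G p \<longleftrightarrow>
     length p \<ge> 3 \<and> set p \<subseteq> verts G \<and> distinct p \<and>
     successively (\<lambda>x y. {x, y} \<in> edges G) p \<and> {last p, hd p} \<in> edges G"

definition acyclic_graph :: "'a graph \<Rightarrow> bool" where
  "acyclic_graph G \<longleftrightarrow> (\<nexists>p. is_cycle G p)"

definition connected_graph :: "'a graph \<Rightarrow> bool" where
  "connected_graph G \<longleftrightarrow> verts G \<noteq> {} \<and> (\<forall>u\<in>verts G. \<forall>v\<in>verts G. \<exists>p. is_path G u p v)"

definition is_tree :: "'a graph \<Rightarrow> bool" where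
  "is_tree T \<longleftrightarrow> simple_graph T \<and> connected_graph T \<and> acyclic_graph T"

text \<open>Paths are lists of vertices, so the number of edges is one less than the length.\<close>

definition tree_dist :: "'a graph \<Rightarrow> 'a \<Rightarrow> 'a \<Rightarrow> nat" where
  "tree_dist T u v = length (THE p. is_path T u p v) - 1"

text \<open>A connected component is represented by its vertex set.\<close>

definition components :: "'a graph \<Rightarrow> 'a set set" where
  "components G = (\<lambda>u. {v. \<exists>p. is_path G u p v}) ` verts G"

definition subgraph :: "'a graph \<Rightarrow> 'a graph \<Rightarrow> bool" where
  "subgraph H G \<longleftrightarrow> simple_graph H \<and> verts H \<subseteq> verts G \<and> edges H \<subseteq> edges G"

definition spanning_forest :: "'a graph \<Rightarrow> 'a graph \<Rightarrow> bool" where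
  "spanning_forest T F \<longleftrightarrow> subgraph F T \<and> verts F = verts T \<and> acyclic_graph F"

definition rooted_forests :: "'a graph \<Rightarrow> 'a set \<Rightarrow> 'a graph set" (\<open>\<F>\<^sub>1\<close>) where
  "\<F>\<^sub>1 T S = {F. spanning_forest T F \<and> card (components F) = card S \<and>
                  (\<forall>C\<in>components F. card (C \<inter> S) = 1)}"

definition floating_forests :: "'a graph \<Rightarrow> 'a set \<Rightarrow> 'a graph set" (\<open>\<F>\<^sub>2\<close>) where
  "\<F>\<^sub>2 T S = {F. spanning_forest T F \<and> card (components F) = card S + 1 \<and>
                  (\<exists>!C. C \<in> components F \<and> C \<inter> S = {})}"

definition floating_component :: "'a set \<Rightarrow> 'a graph \<Rightarrow> 'a set" where
  "floating_component S F = (THE C. C \<in> components F \<and> C \<inter> S = {})"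

definition boundary_degree :: "'a graph \<Rightarrow> 'a set \<Rightarrow> nat" (\<open>\<delta>\<close>) where
  "\<delta> T C = card {v \<in> verts T. v \<notin> C \<and> (\<exists>u\<in>C. {u, v} \<in> edges T)}"

text \<open>
  Matrices are indexed from \<open>0\<close>, but the vertices of the trees in question are \<open>1, \<dots>, n\<close>:
  row or column \<open>i\<close> of a matrix belongs to the vertex \<open>Suc i\<close>.
\<close>

definition distance_matrix :: "nat \<Rightarrow> nat graph \<Rightarrow> int mat" where
  "distance_matrix n T = mat n n (\<lambda>(i, j). int (tree_dist T (Suc i) (Suc j)))"

definition principal_submatrix :: "'a mat \<Rightarrow> nat set \<Rightarrow> 'a mat" where
  "principal_submatrix A S = submatrix A {i. Suc i \<in> S} {i. Suc i \<in> S}"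

end

theory Submission
  imports Defs
begin

text \<open>
  Write \<open>\<mu> s = \<Sum>F. 2 - \<delta> (F\<^sub>s)\<close>, where \<open>F\<close> ranges over the \<open>S\<close>-rooted forests and \<open>F\<^sub>s\<close> is the component
  of \<open>s\<close>, let \<open>A\<close> be the number of these forests and \<open>\<lambda>\<close> the right-hand factor of the claim.  Then
  \<open>\<Sum>s. \<mu> s = 2 A\<close> and \<open>D[S] \<mu> = \<lambda> 1\<close>, so \<open>N (-\<lambda>, \<mu>) = (2 A, 0)\<close> for the matrix \<open>N\<close> obtained by bordering
  \<open>D[S]\<close> with a row and a column of ones and a zero corner, and Cramer's rule yields
  \<open>-\<lambda> det N = 2 A det D[S]\<close>.  Together with \<open>2 det N = (-2)^m A\<close> and \<open>A > 0\<close> this is the claim.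

  Both facts about \<open>N\<close> are proved by induction on the tree, attaching a leaf \<open>v\<close> to a vertex \<open>u\<close>.
  If \<open>v \<notin> S\<close>, then \<open>v\<close> either hangs on \<open>u\<close> in a forest or floats alone; if \<open>S = insert v S'\<close>, then the
  forests with and without the edge \<open>{u, v}\<close> correspond to those of the smaller tree with root sets
  \<open>insert u S'\<close> and \<open>S'\<close>.  For the induction to close, \<open>D[S] \<mu> = \<lambda> 1\<close> has to be evaluated at all
  vertices, not only at those of \<open>S\<close>, jointly with the analogous sums over the forests in which a
  given vertex belongs to the component of \<open>s\<close>.
\<close>

section \<open>Forests as sets of edges\<close>

text \<open>Reflexive-transitive closure of adjacency instead of vertex lists: walks may repeat
  vertices, so edges can be appended freely. \<open>is_path_if_linked\<close> and
  \<open>linked_if_is_path\<close> relate this to paths.\<close>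

definition linked :: "'a set set \<Rightarrow> 'a \<Rightarrow> 'a \<Rightarrow> bool" where
  "linked F x y \<longleftrightarrow> (x, y) \<in> {(x, y). {x, y} \<in> F}\<^sup>*"

lemma linked_refl [simp]: "linked F x x"
  by (simp add: linked_def)

lemma linked_edge: "{x, y} \<in> F \<Longrightarrow> linked F x y"
  by (auto simp: linked_def)

lemma linked_sym: "linked F x y \<Longrightarrow> linked F y x"
proof -
  have "sym ({(x, y). {x, y} \<in> F}\<^sup>*)"
    by (intro sym_rtrancl) (auto simp: sym_def insert_commute)
  then show "linked F x y \<Longrightarrow> linked F y x"
    by (auto simp: linked_def sym_def)
qed

lemma linked_trans: "linked F x y \<Longrightarrow> linked F y z \<Longrightarrow> linked F x z"
  by (auto simp: linked_def)

lemma linked_mono: "linked F x y \<Longrightarrow> F \<subseteq> F' \<Longrightarrow> linked F' x y"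
  unfolding linked_def by (erule rtrancl_mono[THEN subsetD, rotated]) auto

lemma linked_induct [consumes 1, case_names refl step]:
  assumes "linked F x y" "P x"
    and "\<And>y z. linked F x y \<Longrightarrow> {y, z} \<in> F \<Longrightarrow> P y \<Longrightarrow> P z"
  shows "P y"
  using assms(1) unfolding linked_def
  by (induction rule: rtrancl_induct) (use assms(2,3) in \<open>auto simp: linked_def\<close>)

lemma linked_closed:
  assumes "linked F x y" "x \<in> V" "\<And>e. e \<in> F \<Longrightarrow> e \<subseteq> V"
  shows "y \<in> V"
  using assms(1) by (induction rule: linked_induct) (use assms(2,3) in auto)

lemma linked_outside:
  assumes "v \<notin> V" "\<And>e. e \<in> F \<Longrightarrow> e \<subseteq> V"
  shows "linked F v y \<longleftrightarrow> y = v" and "linked F y v \<longleftrightarrow> y = v"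
proof -
  have "z = v" if "linked F v z" for z
    using that by (induction rule: linked_induct) (use assms in auto)
  then show "linked F v y \<longleftrightarrow> y = v" "linked F y v \<longleftrightarrow> y = v"
    using linked_sym[of F] by auto
qed

section \<open>Roots, floating components and forest counts\<close>

definition separates :: "'a set set \<Rightarrow> 'a set \<Rightarrow> bool" where
  "separates F S \<longleftrightarrow> (\<forall>s\<in>S. \<forall>t\<in>S. linked F s t \<longrightarrow> s = t)"

text \<open>In a floating forest this is the floating component, see
  \<open>is_floating_component\<close>.\<close>

definition unrooted :: "'a set \<Rightarrow> 'a set \<Rightarrow> 'a set set \<Rightarrow> 'a set" where
  "unrooted V S F = {x \<in> V. \<forall>s\<in>S. \<not> linked F x s}"

definition is_rooted :: "'a set \<Rightarrow> 'a set \<Rightarrow> 'a set set \<Rightarrow> bool" where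
  "is_rooted V S F \<longleftrightarrow> separates F S \<and> unrooted V S F = {}"

definition is_floating :: "'a set \<Rightarrow> 'a set \<Rightarrow> 'a set set \<Rightarrow> bool" where
  "is_floating V S F \<longleftrightarrow> separates F S \<and> unrooted V S F \<noteq> {} \<and>
     (\<forall>x\<in>unrooted V S F. \<forall>y\<in>unrooted V S F. linked F x y)"

text \<open>Sums of indicators over all edge sets, so that counts and weighted sums split alike when
  an edge is added. In a tree every set of edges is a forest, see
  \<open>spanning_forest_iff\<close>.\<close>

definition num_rooted :: "'a set \<Rightarrow> 'a set set \<Rightarrow> 'a set \<Rightarrow> int" where
  "num_rooted V E S = (\<Sum>F\<in>Pow E. of_bool (is_rooted V S F))"

definition num_floating :: "'a set \<Rightarrow> 'a set set \<Rightarrow> 'a set \<Rightarrow> 'a \<Rightarrow> 'a \<Rightarrow> int" where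
  "num_floating V E S a b =
     (\<Sum>F\<in>Pow E. of_bool (is_floating V S F \<and> a \<in> unrooted V S F \<and> b \<in> unrooted V S F))"

definition floating_weight :: "'a set \<Rightarrow> 'a set set \<Rightarrow> 'a set \<Rightarrow> 'a \<Rightarrow> int" where
  "floating_weight V E S w =
     (\<Sum>F\<in>Pow E. if is_floating V S F \<and> w \<in> unrooted V S F
                   then 2 - int (\<delta> (Graph V E) (unrooted V S F)) else 0)"

definition forest_sum :: "'a set \<Rightarrow> 'a set set \<Rightarrow> 'a set \<Rightarrow> int" where
  "forest_sum V E S = (int (card S) - 1) * num_rooted V E S -
     (\<Sum>F\<in>Pow E. if is_floating V S F
                   then (int (\<delta> (Graph V E) (unrooted V S F)) - 1) *
                        (int (\<delta> (Graph V E) (unrooted V S F)) - 4) else 0)"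

lemma in_unrooted_not_root: "s \<in> S \<Longrightarrow> s \<notin> unrooted V S F"
  using linked_refl by (fastforce simp: unrooted_def)

lemma num_floating_eq_0:
  assumes "a \<in> S \<or> b \<in> S"
  shows "num_floating V E S a b = 0"
proof -
  have "\<not> (a \<in> unrooted V S F \<and> b \<in> unrooted V S F)" for F
    using assms by (auto dest: in_unrooted_not_root)
  then show ?thesis by (auto simp: num_floating_def intro!: sum.neutral)
qed

lemma floating_weight_eq_0: "w \<in> S \<Longrightarrow> floating_weight V E S w = 0"
  by (auto simp: floating_weight_def in_unrooted_not_root)

lemma num_floating_commute: "num_floating V E S a b = num_floating V E S b a"
  unfolding num_floating_def by (intro sum.cong) auto

lemma separates_insert:
  "separates F (insert u S) \<and> u \<notin> S \<longleftrightarrow> separates F S \<and> (\<forall>s\<in>S. \<not> linked F u s)"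
  unfolding separates_def using linked_sym[of F] by (metis insert_iff linked_refl)

text \<open>Declaring \<open>u\<close> a root turns the floating component into the component of
  \<open>u\<close>, and forgetting this root undoes it. The guard \<open>u \<notin> S\<close>
  excludes \<open>insert u S = S\<close>, where no root is added.\<close>

lemma is_floating_iff_is_rooted_insert:
  assumes "u \<in> V"
  shows "is_floating V S F \<and> u \<in> unrooted V S F \<longleftrightarrow> u \<notin> S \<and> is_rooted V (insert u S) F"
    (is "?l \<longleftrightarrow> ?r")
proof
  assume l: ?l
  then have "\<forall>s\<in>S. \<not> linked F u s" by (auto simp: unrooted_def)
  moreover have "unrooted V (insert u S) F = {}"
    using l by (auto simp: is_floating_def unrooted_def)
  ultimately show ?r using l separates_insert[of F u S]
    by (auto simp: is_floating_def is_rooted_def)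
next
  assume r: ?r
  then have s: "separates F S" "\<forall>s\<in>S. \<not> linked F u s"
    using separates_insert[of F u S] by (auto simp: is_rooted_def)
  then have u: "u \<in> unrooted V S F" using assms by (auto simp: unrooted_def)
  have "linked F x u" if "x \<in> unrooted V S F" for x
    using r that by (auto simp: is_rooted_def unrooted_def)
  then have "linked F x y" if "x \<in> unrooted V S F" "y \<in> unrooted V S F" for x y
    using that linked_sym linked_trans by metis
  with s u show ?l by (auto simp: is_floating_def)
qed

lemma num_floating_diag:
  "u \<in> V \<Longrightarrow> num_floating V E S u u = (if u \<in> S then 0 else num_rooted V E (insert u S))"
  by (auto simp: num_floating_def num_rooted_def is_floating_iff_is_rooted_insert)

section \<open>Attaching a leaf\<close>

lemma sum_Pow_insert:
  fixes g :: "'a set \<Rightarrow> 'b :: comm_monoid_add"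
  assumes "finite E" "e \<notin> E"
  shows "(\<Sum>F\<in>Pow (insert e E). g F) = (\<Sum>F\<in>Pow E. g F + g (insert e F))"
proof -
  have inj: "inj_on (insert e) (Pow E)"
    using assms(2) by (auto intro!: inj_onI)
  have "(\<Sum>F\<in>Pow (insert e E). g F) = (\<Sum>F\<in>Pow E. g F) + (\<Sum>F\<in>insert e ` Pow E. g F)"
    unfolding Pow_insert using assms by (intro sum.union_disjoint) auto
  also have "(\<Sum>F\<in>insert e ` Pow E. g F) = (\<Sum>F\<in>Pow E. g (insert e F))"
    using inj by (simp add: sum.reindex)
  finally show ?thesis by (simp add: sum.distrib)
qed

locale leaf_extension =
  fixes V :: "'a set" and E :: "'a set set" and u v :: 'a
  assumes finite_V: "finite V" and edge_subset: "e \<in> E \<Longrightarrow> e \<subseteq> V"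
    and u_in: "u \<in> V" and v_notin: "v \<notin> V"
begin

abbreviation "V\<^sub>v \<equiv> insert v V"
abbreviation "E\<^sub>v \<equiv> insert {u, v} E"

text \<open>Contraction of the pendant edge onto \<open>u\<close>.\<close>

definition retract :: "'a \<Rightarrow> 'a" where
  "retract x = (if x = v then u else x)"

lemma retract_simps [simp]: "retract v = u" "x \<in> V \<Longrightarrow> retract x = x" "retract u = u"
  using u_in v_notin by (auto simp: retract_def)

lemma u_neq_v: "u \<noteq> v" "v \<noteq> u"
  using u_in v_notin by auto

lemma finite_E: "finite E"
  using finite_subset[of E "Pow V"] edge_subset finite_V by auto

lemma edge_notin: "{u, v} \<notin> E" "{x, v} \<notin> E" "{v, x} \<notin> E"
  using edge_subset v_notin by auto

lemma sum_forests: "(\<Sum>F\<in>Pow E\<^sub>v. g F) = (\<Sum>F\<in>Pow E. g F + g (insert {u, v} F))"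
  for g :: "_ \<Rightarrow> int"
  by (rule sum_Pow_insert[OF finite_E edge_notin(1)])

lemma linked_leaf:
  assumes "F \<subseteq> E"
  shows "linked F v y \<longleftrightarrow> y = v" and "linked F y v \<longleftrightarrow> y = v"
  using linked_outside[OF v_notin, of F] edge_subset assms by auto

text \<open>Under the contraction a step along \<open>{u, v}\<close> becomes stationary, while every
  other step is an edge of \<open>F\<close> and avoids \<open>v\<close>.\<close>

lemma linked_insert:
  assumes "F \<subseteq> E"
  shows "linked (insert {u, v} F) a b \<longleftrightarrow> linked F (retract a) (retract b)"
proof
  assume "linked (insert {u, v} F) a b"
  then show "linked F (retract a) (retract b)"
  proof (induction rule: linked_induct)
    case (step y z)
    have "linked F (retract y) (retract z)"
    proof (cases "{y, z} = {u, v}")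
      case True
      then show ?thesis by (auto simp: doubleton_eq_iff)
    next
      case False
      then have "{y, z} \<in> F" using step by auto
      moreover from this have "y \<in> V" "z \<in> V" using edge_subset assms by auto
      ultimately show ?thesis by (simp add: linked_edge)
    qed
    with step show ?case using linked_trans by metis
  qed auto
next
  let ?F = "insert {u, v} F"
  assume "linked F (retract a) (retract b)"
  then have "linked ?F (retract a) (retract b)" by (rule linked_mono) auto
  moreover have "linked ?F x (retract x)" for x
    by (auto simp: retract_def insert_commute intro: linked_edge)
  ultimately show "linked ?F a b" using linked_trans linked_sym by metis
qed

section \<open>Attaching a leaf that is not a root\<close>

context
  fixes S assumes S: "S \<subseteq> V"
begin

lemma v_notin_S: "v \<notin> S"
  using S v_notin by auto

lemma unrooted_out:
  "F \<subseteq> E \<Longrightarrow> unrooted V\<^sub>v S F = insert v (unrooted V S F)"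
  using v_notin_S by (auto simp: unrooted_def linked_leaf)

lemma unrooted_in:
  assumes "F \<subseteq> E"
  shows "unrooted V\<^sub>v S (insert {u, v} F) = {x \<in> V\<^sub>v. retract x \<in> unrooted V S F}"
proof -
  have "retract s = s" if "s \<in> S" for s using that S by auto
  then show ?thesis using assms u_in
    by (auto simp: unrooted_def linked_insert)
qed

lemma separates_in:
  assumes "F \<subseteq> E"
  shows "separates (insert {u, v} F) S \<longleftrightarrow> separates F S"
proof -
  have "retract s = s" if "s \<in> S" for s using that S by auto
  then show ?thesis using assms by (auto simp: separates_def linked_insert)
qed

lemma is_rooted_out: "F \<subseteq> E \<Longrightarrow> \<not> is_rooted V\<^sub>v S F"
  by (auto simp: is_rooted_def unrooted_out)

lemma is_rooted_in: "F \<subseteq> E \<Longrightarrow> is_rooted V\<^sub>v S (insert {u, v} F) \<longleftrightarrow> is_rooted V S F"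
proof -
  have "unrooted V S F \<subseteq> V" by (auto simp: unrooted_def)
  then have "{x \<in> V\<^sub>v. retract x \<in> unrooted V S F} = {} \<longleftrightarrow> unrooted V S F = {}"
    using u_in by (force simp: subset_eq)
  then show "F \<subseteq> E \<Longrightarrow> ?thesis" by (simp add: is_rooted_def unrooted_in separates_in)
qed

text \<open>Without the new edge \<open>v\<close> is isolated and unrooted, so it is the whole
  floating component and no vertex of \<open>V\<close> may be unrooted.\<close>

lemma is_floating_out: "F \<subseteq> E \<Longrightarrow> is_floating V\<^sub>v S F \<longleftrightarrow> is_rooted V S F"
proof -
  assume F: "F \<subseteq> E"
  have "v \<notin> unrooted V S F" using v_notin by (auto simp: unrooted_def)
  then show ?thesis
    by (auto simp: is_floating_def is_rooted_def unrooted_out linked_leaf F)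
qed

lemma is_floating_in: "F \<subseteq> E \<Longrightarrow> is_floating V\<^sub>v S (insert {u, v} F) \<longleftrightarrow> is_floating V S F"
proof -
  assume F: "F \<subseteq> E"
  have 2: "(\<forall>x\<in>{x \<in> V\<^sub>v. retract x \<in> U}. \<forall>y\<in>{x \<in> V\<^sub>v. retract x \<in> U}.
      linked F (retract x) (retract y)) \<longleftrightarrow> (\<forall>x\<in>U. \<forall>y\<in>U. linked F x y)" if "U \<subseteq> V" for U
  proof -
    \<comment> \<open>\<open>retract\<close> fixes \<open>U\<close> pointwise, hence maps the
      preimage of \<open>U\<close> onto \<open>U\<close>; this transfers the quantifiers.\<close>
    have "U = retract ` {x \<in> V\<^sub>v. retract x \<in> U}" (is "_ = retract ` ?A")
      using that by (force simp: image_iff subset_eq)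
    then have "(\<forall>x\<in>U. \<forall>y\<in>U. linked F x y) \<longleftrightarrow>
        (\<forall>x\<in>retract ` ?A. \<forall>y\<in>retract ` ?A. linked F x y)" by (rule arg_cong)
    then show ?thesis by simp
  qed
  have U: "unrooted V S F \<subseteq> V" by (auto simp: unrooted_def)
  note 2 = 2[OF U]
  have 1: "{x \<in> V\<^sub>v. retract x \<in> unrooted V S F} = {} \<longleftrightarrow> unrooted V S F = {}"
    using U u_in by (force simp: subset_eq)
  show ?thesis
    unfolding is_floating_def separates_in[OF F] unrooted_in[OF F] linked_insert[OF F] 1 2 ..
qed

text \<open>A leaf floating alone thus has weight \<open>2 - 1 = 1\<close> in
  \<open>floating_weight\<close>, while the factor \<open>\<delta> - 1\<close> removes it from
  \<open>forest_sum\<close>.\<close>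

lemma boundary_degree_leaf: "\<delta> (Graph V\<^sub>v E\<^sub>v) {v} = 1"
proof -
  have "{x \<in> V\<^sub>v. x \<notin> {v} \<and> (\<exists>w\<in>{v}. {w, x} \<in> E\<^sub>v)} = {u}"
    using u_in v_notin edge_notin by (auto simp: doubleton_eq_iff insert_commute)
  then show ?thesis by (simp add: boundary_degree_def)
qed

text \<open>The vertices \<open>u\<close> and \<open>v\<close> lie on the same side, so the new edge
  crosses no boundary.\<close>

lemma boundary_degree_in:
  assumes "U \<subseteq> V"
  shows "\<delta> (Graph V\<^sub>v E\<^sub>v) {x \<in> V\<^sub>v. retract x \<in> U} = \<delta> (Graph V E) U"
proof -
  have "{y \<in> V\<^sub>v. y \<notin> {x \<in> V\<^sub>v. retract x \<in> U} \<and> (\<exists>w\<in>{x \<in> V\<^sub>v. retract x \<in> U}. {w, y} \<in> E\<^sub>v)}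
    = {y \<in> V. y \<notin> U \<and> (\<exists>w\<in>U. {w, y} \<in> E)}" (is "?l = ?r")
  proof (intro equalityI subsetI)
    fix y assume "y \<in> ?l"
    then obtain w where w: "y \<in> V\<^sub>v" "retract y \<notin> U" "w \<in> V\<^sub>v" "retract w \<in> U" "{w, y} \<in> E\<^sub>v"
      by auto
    then have "{w, y} \<noteq> {u, v}" by (auto simp: doubleton_eq_iff)
    then have "{w, y} \<in> E" using w by auto
    moreover from this have "w \<in> V" "y \<in> V" using edge_subset by auto
    ultimately show "y \<in> ?r" using w by auto
  next
    fix y assume "y \<in> ?r"
    then obtain w where "y \<in> V" "y \<notin> U" "w \<in> U" "{w, y} \<in> E" by auto
    moreover from this have "w \<in> V" using assms by auto
    ultimately show "y \<in> ?l" by (auto intro!: exI[of _ w])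
  qed
  then show ?thesis by (simp add: boundary_degree_def)
qed

lemma num_rooted_nonroot: "num_rooted V\<^sub>v E\<^sub>v S = num_rooted V E S"
  unfolding num_rooted_def sum_forests
  by (intro sum.cong) (auto simp: is_rooted_out is_rooted_in)

text \<open>Either the leaf hangs on \<open>u\<close> and is represented by it, or it floats alone
  beside a rooted forest, which forces \<open>a = v\<close> and \<open>b = v\<close>.\<close>

lemma num_floating_nonroot:
  assumes "a \<in> V\<^sub>v" "b \<in> V\<^sub>v"
  shows "num_floating V\<^sub>v E\<^sub>v S a b = num_floating V E S (retract a) (retract b) +
    of_bool (a = v \<and> b = v) * num_rooted V E S"
  unfolding num_floating_def num_rooted_def sum_forests sum_distrib_left sum.distrib[symmetric]
proof (intro sum.cong refl)
  fix F assume "F \<in> Pow E"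
  then have F: "F \<subseteq> E" by simp
  show "of_bool (is_floating V\<^sub>v S F \<and> a \<in> unrooted V\<^sub>v S F \<and> b \<in> unrooted V\<^sub>v S F) +
        of_bool (is_floating V\<^sub>v S (insert {u, v} F) \<and> a \<in> unrooted V\<^sub>v S (insert {u, v} F) \<and>
          b \<in> unrooted V\<^sub>v S (insert {u, v} F)) =
        (of_bool (is_floating V S F \<and> retract a \<in> unrooted V S F \<and> retract b \<in> unrooted V S F) +
        of_bool (a = v \<and> b = v) * of_bool (is_rooted V S F) :: int)"
    using assms unfolding is_floating_out[OF F] is_floating_in[OF F] unrooted_in[OF F] unrooted_out[OF F]
    by (auto simp: is_rooted_def)
qed

lemma floating_weight_nonroot:
  assumes "w \<in> V\<^sub>v"
  shows "floating_weight V\<^sub>v E\<^sub>v S w = floating_weight V E S (retract w) +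
    of_bool (w = v) * num_rooted V E S"
  unfolding floating_weight_def num_rooted_def sum_forests sum_distrib_left sum.distrib[symmetric]
proof (intro sum.cong refl)
  fix F assume "F \<in> Pow E"
  then have F: "F \<subseteq> E" by simp
  have U: "unrooted V S F \<subseteq> V" by (auto simp: unrooted_def)
  show "(if is_floating V\<^sub>v S F \<and> w \<in> unrooted V\<^sub>v S F
          then 2 - int (\<delta> (Graph V\<^sub>v E\<^sub>v) (unrooted V\<^sub>v S F)) else 0) +
        (if is_floating V\<^sub>v S (insert {u, v} F) \<and> w \<in> unrooted V\<^sub>v S (insert {u, v} F)
          then 2 - int (\<delta> (Graph V\<^sub>v E\<^sub>v) (unrooted V\<^sub>v S (insert {u, v} F))) else 0) =
        (if is_floating V S F \<and> retract w \<in> unrooted V S F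
          then 2 - int (\<delta> (Graph V E) (unrooted V S F)) else 0) +
        of_bool (w = v) * of_bool (is_rooted V S F)"
    using assms
    unfolding is_floating_out[OF F] is_floating_in[OF F] unrooted_in[OF F] unrooted_out[OF F]
      boundary_degree_in[OF U]
    by (auto simp: is_rooted_def boundary_degree_leaf)
qed

lemma forest_sum_nonroot: "forest_sum V\<^sub>v E\<^sub>v S = forest_sum V E S"
proof -
  have "(if is_floating V\<^sub>v S F
          then (int (\<delta> (Graph V\<^sub>v E\<^sub>v) (unrooted V\<^sub>v S F)) - 1) *
               (int (\<delta> (Graph V\<^sub>v E\<^sub>v) (unrooted V\<^sub>v S F)) - 4) else 0) +
        (if is_floating V\<^sub>v S (insert {u, v} F)
          then (int (\<delta> (Graph V\<^sub>v E\<^sub>v) (unrooted V\<^sub>v S (insert {u, v} F))) - 1) *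
               (int (\<delta> (Graph V\<^sub>v E\<^sub>v) (unrooted V\<^sub>v S (insert {u, v} F))) - 4) else 0) =
        (if is_floating V S F
          then (int (\<delta> (Graph V E) (unrooted V S F)) - 1) *
               (int (\<delta> (Graph V E) (unrooted V S F)) - 4) else 0)"
    if F: "F \<subseteq> E" for F
  proof -
    have U: "unrooted V S F \<subseteq> V" by (auto simp: unrooted_def)
    show ?thesis
      unfolding is_floating_out[OF F] is_floating_in[OF F] unrooted_in[OF F] unrooted_out[OF F]
        boundary_degree_in[OF U]
      by (auto simp: is_rooted_def boundary_degree_leaf)
  qed
  then show ?thesis
    unfolding forest_sum_def sum_forests num_rooted_nonroot by simp
qed

section \<open>Attaching a leaf that is a root\<close>

lemma separates_root_out: "F \<subseteq> E \<Longrightarrow> separates F (insert v S) \<longleftrightarrow> separates F S"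
  using v_notin_S by (auto simp: separates_def linked_leaf)

lemma unrooted_root_out:
  "F \<subseteq> E \<Longrightarrow> unrooted V\<^sub>v (insert v S) F = unrooted V S F"
  using v_notin by (auto simp: unrooted_def linked_leaf)

lemma is_rooted_root_out: "F \<subseteq> E \<Longrightarrow> is_rooted V\<^sub>v (insert v S) F \<longleftrightarrow> is_rooted V S F"
  by (simp add: is_rooted_def separates_root_out unrooted_root_out)

lemma is_floating_root_out: "F \<subseteq> E \<Longrightarrow> is_floating V\<^sub>v (insert v S) F \<longleftrightarrow> is_floating V S F"
  by (simp add: is_floating_def separates_root_out unrooted_root_out)

text \<open>Contracting the edge moves the root \<open>v\<close> to \<open>u\<close>; if
  \<open>u\<close> is a root already, two roots are linked.\<close>

lemma separates_root_in:
  assumes "F \<subseteq> E"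
  shows "separates (insert {u, v} F) (insert v S) \<longleftrightarrow> u \<notin> S \<and> separates F (insert u S)"
proof -
  have "retract s = s" if "s \<in> S" for s using that S by auto
  then have "linked (insert {u, v} F) v s \<longleftrightarrow> linked F u s" if "s \<in> S" for s
    using assms that by (simp add: linked_insert)
  then show ?thesis
    using separates_insert[of F u S] separates_insert[of "insert {u, v} F" v S] v_notin_S
      separates_in[OF assms] by metis
qed

lemma unrooted_root_in:
  assumes "F \<subseteq> E"
  shows "unrooted V\<^sub>v (insert v S) (insert {u, v} F) = unrooted V (insert u S) F"
proof -
  have "retract s = s" if "s \<in> S" for s using that S by auto
  then show ?thesis using assms u_in v_notin
    by (auto simp: unrooted_def linked_insert)
qed

lemma is_rooted_root_in:
  "F \<subseteq> E \<Longrightarrow> is_rooted V\<^sub>v (insert v S) (insert {u, v} F) \<longleftrightarrow> u \<notin> S \<and> is_rooted V (insert u S) F"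
  by (auto simp: is_rooted_def separates_root_in unrooted_root_in)

lemma is_floating_root_in:
  assumes F: "F \<subseteq> E"
  shows "is_floating V\<^sub>v (insert v S) (insert {u, v} F) \<longleftrightarrow>
    u \<notin> S \<and> is_floating V (insert u S) F"
proof -
  have "retract x = x" if "x \<in> unrooted V (insert u S) F" for x
    using that by (auto simp: unrooted_def)
  then show ?thesis
    by (auto simp: is_floating_def separates_root_in[OF F] unrooted_root_in[OF F] linked_insert[OF F])
qed

text \<open>The only neighbour of \<open>v\<close> is \<open>u\<close>, so \<open>v\<close> joins
  the boundary exactly when \<open>u\<close> lies inside.\<close>

lemma boundary_degree_root_out:
  assumes "U \<subseteq> V"
  shows "\<delta> (Graph V\<^sub>v E\<^sub>v) U = \<delta> (Graph V E) U + of_bool (u \<in> U)"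
proof -
  have v: "v \<notin> U" using assms v_notin by auto
  have "{y \<in> V\<^sub>v. y \<notin> U \<and> (\<exists>w\<in>U. {w, y} \<in> E\<^sub>v)} =
    {y \<in> V. y \<notin> U \<and> (\<exists>w\<in>U. {w, y} \<in> E)} \<union> (if u \<in> U then {v} else {})"
    using v edge_notin u_neq_v v_notin by (auto simp: doubleton_eq_iff)
  then show ?thesis using finite_V v_notin by (auto simp: boundary_degree_def)
qed

lemma num_rooted_root:
  "num_rooted V\<^sub>v E\<^sub>v (insert v S) =
    (if u \<in> S then 0 else num_rooted V E (insert u S)) + num_rooted V E S"
  unfolding num_rooted_def sum_forests
  by (auto simp: sum.distrib[symmetric] is_rooted_root_out is_rooted_root_in intro!: sum.cong)

lemma num_floating_root:
  "num_floating V\<^sub>v E\<^sub>v (insert v S) a b =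
    (if u \<in> S then 0 else num_floating V E (insert u S) a b) + num_floating V E S a b"
  unfolding num_floating_def sum_forests
  by (auto simp: sum.distrib[symmetric] is_floating_root_out is_floating_root_in
     unrooted_root_out unrooted_root_in intro!: sum.cong)

lemma boundary_degree_root_in:
  "\<delta> (Graph V\<^sub>v E\<^sub>v) (unrooted V (insert u S) F) = \<delta> (Graph V E) (unrooted V (insert u S) F)"
  by (subst boundary_degree_root_out) (auto simp: unrooted_def)

text \<open>In a forest without the new edge, the isolated root \<open>v\<close> raises the boundary
  degree by one if \<open>u\<close> floats; hence the subtracted
  \<open>num_floating\<close>.\<close>

lemma floating_weight_root:
  "floating_weight V\<^sub>v E\<^sub>v (insert v S) w =
    (if u \<in> S then 0 else floating_weight V E (insert u S) w) +
    floating_weight V E S w - num_floating V E S u w"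
proof -
  have eq: "(\<Sum>F\<in>Pow E\<^sub>v. g F) = (if u \<in> S then 0 else \<Sum>F\<in>Pow E. h F) + (\<Sum>F\<in>Pow E. k F) - (\<Sum>F\<in>Pow E. l F)"
    if "\<And>F. F \<subseteq> E \<Longrightarrow> g F + g (insert {u, v} F) = (if u \<in> S then 0 else h F) + k F - l F"
    for g h k l :: "_ \<Rightarrow> int"
    using that by (auto simp: sum_forests sum.distrib[symmetric] sum_subtractf[symmetric] intro!: sum.cong)
  show ?thesis
    unfolding floating_weight_def num_floating_def
  proof (rule eq)
    fix F assume F: "F \<subseteq> E"
    have U: "unrooted V S F \<subseteq> V" by (auto simp: unrooted_def)
    show "(if is_floating V\<^sub>v (insert v S) F \<and> w \<in> unrooted V\<^sub>v (insert v S) F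
          then 2 - int (\<delta> (Graph V\<^sub>v E\<^sub>v) (unrooted V\<^sub>v (insert v S) F)) else 0) +
        (if is_floating V\<^sub>v (insert v S) (insert {u, v} F) \<and>
            w \<in> unrooted V\<^sub>v (insert v S) (insert {u, v} F)
          then 2 - int (\<delta> (Graph V\<^sub>v E\<^sub>v) (unrooted V\<^sub>v (insert v S) (insert {u, v} F))) else 0) =
        (if u \<in> S then 0 else (if is_floating V (insert u S) F \<and> w \<in> unrooted V (insert u S) F
          then 2 - int (\<delta> (Graph V E) (unrooted V (insert u S) F)) else 0)) +
        (if is_floating V S F \<and> w \<in> unrooted V S F
          then 2 - int (\<delta> (Graph V E) (unrooted V S F)) else 0) -
        of_bool (is_floating V S F \<and> u \<in> unrooted V S F \<and> w \<in> unrooted V S F)"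
      unfolding is_floating_root_out[OF F] is_floating_root_in[OF F] unrooted_root_in[OF F]
        unrooted_root_out[OF F] boundary_degree_root_in boundary_degree_root_out[OF U]
      by auto
  qed
qed

text \<open>For \<open>q k = (k - 1) * (k - 4)\<close> one has
  \<open>q (k + 1) - q k = - 2 * (2 - k)\<close>. This yields \<open>2 * floating_weight\<close>,
  from the forests in which \<open>u\<close> floats and \<open>v\<close> is isolated. The extra
  \<open>num_rooted V E S\<close> comes from the additional root counted in the factor
  \<open>card S - 1\<close>.\<close>

lemma forest_sum_root:
  "forest_sum V\<^sub>v E\<^sub>v (insert v S) = (if u \<in> S then 0 else forest_sum V E (insert u S)) +
    forest_sum V E S + num_rooted V E S + 2 * floating_weight V E S u"
proof -
  let ?q = "\<lambda>k. (int k - 1) * (int k - 4)"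
  have eq: "(\<Sum>F\<in>Pow E\<^sub>v. g F) =
      (if u \<in> S then 0 else \<Sum>F\<in>Pow E. h F) + (\<Sum>F\<in>Pow E. k F) - 2 * (\<Sum>F\<in>Pow E. l F)"
    if "\<And>F. F \<subseteq> E \<Longrightarrow> g F + g (insert {u, v} F) = (if u \<in> S then 0 else h F) + k F - 2 * l F"
    for g h k l :: "_ \<Rightarrow> int"
    using that by (auto simp: sum_forests sum.distrib[symmetric] sum_subtractf[symmetric]
      sum_distrib_left intro!: sum.cong)
  have main: "(\<Sum>F\<in>Pow E\<^sub>v. if is_floating V\<^sub>v (insert v S) F
            then ?q (\<delta> (Graph V\<^sub>v E\<^sub>v) (unrooted V\<^sub>v (insert v S) F)) else 0) =
     (if u \<in> S then 0 else (\<Sum>F\<in>Pow E. if is_floating V (insert u S) F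
            then ?q (\<delta> (Graph V E) (unrooted V (insert u S) F)) else 0)) +
     (\<Sum>F\<in>Pow E. if is_floating V S F
            then ?q (\<delta> (Graph V E) (unrooted V S F)) else 0) - 2 * floating_weight V E S u"
    unfolding floating_weight_def
  proof (rule eq)
    fix F assume F: "F \<subseteq> E"
    have U: "unrooted V S F \<subseteq> V" by (auto simp: unrooted_def)
    show "(if is_floating V\<^sub>v (insert v S) F
            then ?q (\<delta> (Graph V\<^sub>v E\<^sub>v) (unrooted V\<^sub>v (insert v S) F)) else 0) +
        (if is_floating V\<^sub>v (insert v S) (insert {u, v} F)
            then ?q (\<delta> (Graph V\<^sub>v E\<^sub>v) (unrooted V\<^sub>v (insert v S) (insert {u, v} F))) else 0) =
        (if u \<in> S then 0 else (if is_floating V (insert u S) F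
            then ?q (\<delta> (Graph V E) (unrooted V (insert u S) F)) else 0)) +
        (if is_floating V S F then ?q (\<delta> (Graph V E) (unrooted V S F)) else 0) -
        2 * (if is_floating V S F \<and> u \<in> unrooted V S F
          then 2 - int (\<delta> (Graph V E) (unrooted V S F)) else 0)"
      unfolding is_floating_root_out[OF F] is_floating_root_in[OF F] unrooted_root_in[OF F]
        unrooted_root_out[OF F] boundary_degree_root_in boundary_degree_root_out[OF U]
      by (auto simp: algebra_simps)
  qed
  have "finite S" using S finite_V finite_subset by auto
  then show ?thesis
    unfolding forest_sum_def main num_rooted_root using v_notin_S by (simp add: algebra_simps)
qed

end

end

section \<open>Forest identities\<close>

text \<open>
  For \<open>s \<in> S\<close>, \<open>num_floating V E (S - {s}) s w\<close> counts the \<open>S\<close>-rooted forests in which \<open>w\<close> lies in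
  the component of \<open>s\<close>, and \<open>floating_weight V E (S - {s}) s\<close> is the sum of \<open>2 - \<delta> C\<close> over the
  components \<open>C\<close> of \<open>s\<close> in these forests.
\<close>

definition forest_identities :: "'a set \<Rightarrow> 'a set set \<Rightarrow> ('a \<Rightarrow> 'a \<Rightarrow> int) \<Rightarrow> bool" where
  "forest_identities V E d \<longleftrightarrow> (\<forall>S\<subseteq>V. \<forall>t\<in>V. \<forall>w\<in>V.
     (\<Sum>s\<in>S. num_floating V E (S - {s}) s w) = num_rooted V E S \<and>
     (\<Sum>s\<in>S. d t s * num_floating V E (S - {s}) s w) =
       d t w * num_rooted V E S - floating_weight V E S w + 2 * num_floating V E S w t \<and>
     (\<Sum>s\<in>S. floating_weight V E (S - {s}) s) = 2 * num_rooted V E S \<and>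
     (\<Sum>s\<in>S. d t s * floating_weight V E (S - {s}) s) =
       forest_sum V E S + 2 * floating_weight V E S t)"

text \<open>If \<open>u \<notin> S\<close>, then \<open>insert u (S - {s})\<close> is
  \<open>insert u S\<close> without \<open>s\<close>; the left sum lacks only the summand
  \<open>s = u\<close> of the full sum, which is subtracted. If \<open>u \<in> S\<close>, both sides
  vanish, by the guard and the hypothesis on \<open>X\<close>.\<close>

lemma sum_insert_swap:
  fixes X :: "'a set \<Rightarrow> 'a \<Rightarrow> int"
  assumes "finite S" and X: "\<And>S s. s \<in> S \<Longrightarrow> X S s = 0"
  shows "(\<Sum>s\<in>S. c s * (if u \<in> S - {s} then 0 else X (insert u (S - {s})) s)) =
    (if u \<in> S then 0 else (\<Sum>s\<in>insert u S. c s * X (insert u S - {s}) s)) - c u * X S u"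
proof (cases "u \<in> S")
  case True
  have "c s * (if u \<in> S - {s} then 0 else X (insert u (S - {s})) s) = 0" if "s \<in> S" for s
    using True X that by (auto simp: insert_absorb)
  then have "(\<Sum>s\<in>S. c s * (if u \<in> S - {s} then 0 else X (insert u (S - {s})) s)) = 0"
    by (intro sum.neutral) blast
  with True X show ?thesis by (simp only: if_True diff_0_right mult_zero_right)
next
  case False
  have "(\<Sum>s\<in>S. c s * X (insert u (S - {s})) s) = (\<Sum>s\<in>S. c s * X (insert u S - {s}) s)"
    using False by (intro sum.cong) (auto simp: insert_Diff_if)
  moreover have "insert u S - {u} = S" using False by auto
  ultimately show ?thesis using False assms(1) by simp
qed

section \<open>Sums over the roots after attaching a leaf\<close>

context leaf_extension
begin

lemma sum_num_floating_nonroot: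
  assumes "S \<subseteq> V" "w \<in> V\<^sub>v"
  shows "(\<Sum>s\<in>S. c s * num_floating V\<^sub>v E\<^sub>v (S - {s}) s w) =
    (\<Sum>s\<in>S. c s * num_floating V E (S - {s}) s (retract w))"
proof (rule sum.cong[OF refl])
  fix s assume "s \<in> S"
  then have s: "s \<in> V" "s \<noteq> v" and S: "S - {s} \<subseteq> V" using assms v_notin by auto
  show "c s * num_floating V\<^sub>v E\<^sub>v (S - {s}) s w = c s * num_floating V E (S - {s}) s (retract w)"
    using s assms by (subst num_floating_nonroot[OF S]) auto
qed

lemma sum_floating_weight_nonroot:
  assumes "S \<subseteq> V"
  shows "(\<Sum>s\<in>S. c s * floating_weight V\<^sub>v E\<^sub>v (S - {s}) s) =
    (\<Sum>s\<in>S. c s * floating_weight V E (S - {s}) s)"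
proof (rule sum.cong[OF refl])
  fix s assume "s \<in> S"
  then have s: "s \<in> V" "s \<noteq> v" and S: "S - {s} \<subseteq> V" using assms v_notin by auto
  show "c s * floating_weight V\<^sub>v E\<^sub>v (S - {s}) s = c s * floating_weight V E (S - {s}) s"
    using s assms by (subst floating_weight_nonroot[OF S]) auto
qed

lemma insert_v_Diff:
  assumes "S \<subseteq> V" 
  shows "insert v S - {v} = S" and "s \<in> S \<Longrightarrow> insert v S - {s} = insert v (S - {s})"
  using assms v_notin by auto

text \<open>In the summand \<open>s = v\<close> the leaf is no longer a root; the others split by
  the new edge and are regrouped by \<open>sum_insert_swap\<close>. The coefficients
  \<open>c\<close> are later constant \<open>1\<close> or distances from \<open>t\<close>; for
  distances \<open>c v - c u\<close> is \<open>1\<close> if \<open>t \<in> V\<close> and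
  \<open>-1\<close> if \<open>t = v\<close>.\<close>

lemma sum_num_floating_root:
  assumes S: "S \<subseteq> V" and w: "w \<in> V"
  shows "(\<Sum>s\<in>insert v S. c s * num_floating V\<^sub>v E\<^sub>v (insert v S - {s}) s w) =
    (c v - c u) * num_floating V E S u w +
    (if u \<in> S then 0 else \<Sum>s\<in>insert u S. c s * num_floating V E (insert u S - {s}) s w) +
    (\<Sum>s\<in>S. c s * num_floating V E (S - {s}) s w)"
proof -
  have fin: "finite S" using S finite_V finite_subset by auto
  have 1: "num_floating V\<^sub>v E\<^sub>v S v w = num_floating V E S u w"
    using w v_notin by (subst num_floating_nonroot[OF S]) auto
  have 2: "num_floating V\<^sub>v E\<^sub>v (insert v S - {s}) s w =
      (if u \<in> S - {s} then 0 else num_floating V E (insert u (S - {s})) s w) +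
      num_floating V E (S - {s}) s w" if "s \<in> S" for s
  proof -
    have S': "S - {s} \<subseteq> V" using S by auto
    show ?thesis unfolding insert_v_Diff(2)[OF S that] num_floating_root[OF S'] ..
  qed
  have "(\<Sum>s\<in>insert v S. c s * num_floating V\<^sub>v E\<^sub>v (insert v S - {s}) s w) =
    c v * num_floating V E S u w +
    (\<Sum>s\<in>S. c s * ((if u \<in> S - {s} then 0 else num_floating V E (insert u (S - {s})) s w) +
      num_floating V E (S - {s}) s w))"
    using fin v_notin_S[OF S] insert_v_Diff(1)[OF S] by (simp add: 1 2)
  also have "\<dots> = c v * num_floating V E S u w +
    (\<Sum>s\<in>S. c s * (if u \<in> S - {s} then 0 else num_floating V E (insert u (S - {s})) s w)) +
    (\<Sum>s\<in>S. c s * num_floating V E (S - {s}) s w)"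
    by (simp only: distrib_left sum.distrib add.assoc)
  also have "(\<Sum>s\<in>S. c s * (if u \<in> S - {s} then 0 else num_floating V E (insert u (S - {s})) s w)) =
    (if u \<in> S then 0 else \<Sum>s\<in>insert u S. c s * num_floating V E (insert u S - {s}) s w) -
    c u * num_floating V E S u w"
    by (rule sum_insert_swap[OF fin]) (simp add: num_floating_eq_0)
  finally show ?thesis by (simp add: algebra_simps)
qed

text \<open>The vertex \<open>v\<close> can float only in the summand that removes it from the
  roots.\<close>

lemma sum_num_floating_root_leaf:
  assumes S: "S \<subseteq> V"
  shows "(\<Sum>s\<in>insert v S. c s * num_floating V\<^sub>v E\<^sub>v (insert v S - {s}) s v) =
    c v * (num_floating V E S u u + num_rooted V E S)"
proof -
  have fin: "finite S" using S finite_V finite_subset by auto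
  have 1: "num_floating V\<^sub>v E\<^sub>v S v v = num_floating V E S u u + num_rooted V E S"
    by (subst num_floating_nonroot[OF S]) auto
  have 2: "num_floating V\<^sub>v E\<^sub>v (insert v S - {s}) s v = 0" if "s \<in> S" for s
    using insert_v_Diff(2)[OF S that] by (simp add: num_floating_eq_0)
  show ?thesis
    using fin v_notin_S[OF S] insert_v_Diff(1)[OF S] by (simp add: 1 2)
qed

text \<open>The term \<open>c v * num_rooted V E S\<close> stems from the forests with component
  \<open>{v}\<close>, the last sum from the boundary degrees raised by an isolated \<open>v\<close>.
  Because of that last sum, the induction for the weights also needs the identities for
  \<open>num_floating\<close>, at \<open>w = u\<close>.\<close>

lemma sum_floating_weight_root:
  assumes S: "S \<subseteq> V"
  shows "(\<Sum>s\<in>insert v S. c s * floating_weight V\<^sub>v E\<^sub>v (insert v S - {s}) s) =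
    (c v - c u) * floating_weight V E S u + c v * num_rooted V E S +
    (if u \<in> S then 0 else \<Sum>s\<in>insert u S. c s * floating_weight V E (insert u S - {s}) s) +
    (\<Sum>s\<in>S. c s * floating_weight V E (S - {s}) s) -
    (\<Sum>s\<in>S. c s * num_floating V E (S - {s}) s u)"
proof -
  have fin: "finite S" using S finite_V finite_subset by auto
  have 1: "floating_weight V\<^sub>v E\<^sub>v S v = floating_weight V E S u + num_rooted V E S"
    by (subst floating_weight_nonroot[OF S]) auto
  have 2: "floating_weight V\<^sub>v E\<^sub>v (insert v S - {s}) s =
      (if u \<in> S - {s} then 0 else floating_weight V E (insert u (S - {s})) s) +
      (floating_weight V E (S - {s}) s - num_floating V E (S - {s}) s u)" if "s \<in> S" for s
  proof -
    have S': "S - {s} \<subseteq> V" using S by auto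
    show ?thesis
      unfolding insert_v_Diff(2)[OF S that] floating_weight_root[OF S'] num_floating_commute[of _ _ _ u s]
      by simp
  qed
  have "(\<Sum>s\<in>insert v S. c s * floating_weight V\<^sub>v E\<^sub>v (insert v S - {s}) s) =
    c v * (floating_weight V E S u + num_rooted V E S) +
    (\<Sum>s\<in>S. c s * ((if u \<in> S - {s} then 0 else floating_weight V E (insert u (S - {s})) s) +
      (floating_weight V E (S - {s}) s - num_floating V E (S - {s}) s u)))"
    using fin v_notin_S[OF S] insert_v_Diff(1)[OF S] by (simp add: 1 2)
  also have "\<dots> = c v * (floating_weight V E S u + num_rooted V E S) +
    (\<Sum>s\<in>S. c s * (if u \<in> S - {s} then 0 else floating_weight V E (insert u (S - {s})) s)) +
    ((\<Sum>s\<in>S. c s * floating_weight V E (S - {s}) s) -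
     (\<Sum>s\<in>S. c s * num_floating V E (S - {s}) s u))"
    by (simp only: distrib_left right_diff_distrib sum.distrib sum_subtractf add.assoc)
  also have "(\<Sum>s\<in>S. c s * (if u \<in> S - {s} then 0 else floating_weight V E (insert u (S - {s})) s)) =
    (if u \<in> S then 0 else \<Sum>s\<in>insert u S. c s * floating_weight V E (insert u S - {s}) s) -
    c u * floating_weight V E S u"
    by (rule sum_insert_swap[OF fin]) (simp add: floating_weight_eq_0)
  finally show ?thesis by (simp add: algebra_simps)
qed

section \<open>Induction step of the forest identities\<close>

context
  fixes d d' :: "'a \<Rightarrow> 'a \<Rightarrow> int"
  assumes d'_in: "\<And>a b. a \<in> V \<Longrightarrow> b \<in> V \<Longrightarrow> d' a b = d a b"
    and d'_leaf: "\<And>b. b \<in> V \<Longrightarrow> d' v b = d u b + 1" "\<And>a. a \<in> V \<Longrightarrow> d' a v = d a u + 1" "d' v v = 0"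
    and d_refl: "d u u = 0"
    and identities: "forest_identities V E d"
begin

lemma sum_num_floating:
  assumes "S \<subseteq> V" "w \<in> V"
  shows "(\<Sum>s\<in>S. num_floating V E (S - {s}) s w) = num_rooted V E S"
  using identities assms u_in unfolding forest_identities_def by blast

lemma sum_dist_num_floating:
  assumes "S \<subseteq> V" "t \<in> V" "w \<in> V"
  shows "(\<Sum>s\<in>S. d t s * num_floating V E (S - {s}) s w) =
    d t w * num_rooted V E S - floating_weight V E S w + 2 * num_floating V E S w t"
  using identities assms unfolding forest_identities_def by blast

lemma sum_floating_weight:
  assumes "S \<subseteq> V"
  shows "(\<Sum>s\<in>S. floating_weight V E (S - {s}) s) = 2 * num_rooted V E S"
  using identities assms u_in unfolding forest_identities_def by blast

lemma sum_dist_floating_weight: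
  assumes "S \<subseteq> V" "t \<in> V"
  shows "(\<Sum>s\<in>S. d t s * floating_weight V E (S - {s}) s) =
    forest_sum V E S + 2 * floating_weight V E S t"
  using identities assms u_in unfolding forest_identities_def by blast

lemma dist_sum_in:
  assumes "S \<subseteq> V" "t \<in> V"
  shows "(\<Sum>s\<in>S. d' t s * f s) = (\<Sum>s\<in>S. d t s * f s)"
  using assms by (intro sum.cong) (auto simp: d'_in subset_eq)

lemma dist_sum_leaf:
  assumes "S \<subseteq> V"
  shows "(\<Sum>s\<in>S. d' v s * f s) = (\<Sum>s\<in>S. d u s * f s) + (\<Sum>s\<in>S. f s)"
  unfolding sum.distrib[symmetric]
  using assms by (intro sum.cong) (auto simp: d'_leaf subset_eq algebra_simps)

text \<open>Everything reduces to the smaller tree with \<open>t\<close> and \<open>w\<close>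
  contracted. For \<open>t = v\<close> all distances to roots grow by one, and the extra sum is
  evaluated by the corresponding identity without distances.\<close>

lemma identities_nonroot:
  assumes S: "S \<subseteq> V" and t: "t \<in> V\<^sub>v" and w: "w \<in> V\<^sub>v"
  shows "(\<Sum>s\<in>S. num_floating V\<^sub>v E\<^sub>v (S - {s}) s w) = num_rooted V\<^sub>v E\<^sub>v S"
    and "(\<Sum>s\<in>S. d' t s * num_floating V\<^sub>v E\<^sub>v (S - {s}) s w) =
       d' t w * num_rooted V\<^sub>v E\<^sub>v S - floating_weight V\<^sub>v E\<^sub>v S w + 2 * num_floating V\<^sub>v E\<^sub>v S w t"
    and "(\<Sum>s\<in>S. floating_weight V\<^sub>v E\<^sub>v (S - {s}) s) = 2 * num_rooted V\<^sub>v E\<^sub>v S"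
    and "(\<Sum>s\<in>S. d' t s * floating_weight V\<^sub>v E\<^sub>v (S - {s}) s) =
       forest_sum V\<^sub>v E\<^sub>v S + 2 * floating_weight V\<^sub>v E\<^sub>v S t"
proof -
  have r: "retract w \<in> V" "retract t \<in> V" using t w u_in by (auto simp: retract_def)
  note rules = num_rooted_nonroot[OF S] num_floating_nonroot[OF S w t]
    floating_weight_nonroot[OF S w] floating_weight_nonroot[OF S t] forest_sum_nonroot[OF S]
    sum_num_floating_nonroot[OF S w] sum_floating_weight_nonroot[OF S]
    sum_num_floating_nonroot[OF S w, of "\<lambda>_. 1", simplified]
    sum_floating_weight_nonroot[OF S, of "\<lambda>_. 1", simplified]
  show "(\<Sum>s\<in>S. num_floating V\<^sub>v E\<^sub>v (S - {s}) s w) = num_rooted V\<^sub>v E\<^sub>v S"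
    "(\<Sum>s\<in>S. floating_weight V\<^sub>v E\<^sub>v (S - {s}) s) = 2 * num_rooted V\<^sub>v E\<^sub>v S"
    unfolding rules using sum_num_floating[OF S r(1)] sum_floating_weight[OF S] by auto
  have t_cases: "t = v \<or> t \<in> V \<and> t \<noteq> v" and w_cases: "w = v \<or> w \<in> V \<and> w \<noteq> v"
    using t w v_notin by auto
  show "(\<Sum>s\<in>S. d' t s * num_floating V\<^sub>v E\<^sub>v (S - {s}) s w) =
       d' t w * num_rooted V\<^sub>v E\<^sub>v S - floating_weight V\<^sub>v E\<^sub>v S w + 2 * num_floating V\<^sub>v E\<^sub>v S w t"
    unfolding rules using t_cases w_cases r u_in
    by (auto simp: dist_sum_leaf[OF S] dist_sum_in[OF S] sum_num_floating[OF S]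
        sum_dist_num_floating[OF S] d'_leaf d'_in d_refl algebra_simps)
  show "(\<Sum>s\<in>S. d' t s * floating_weight V\<^sub>v E\<^sub>v (S - {s}) s) =
       forest_sum V\<^sub>v E\<^sub>v S + 2 * floating_weight V\<^sub>v E\<^sub>v S t"
    unfolding rules using t_cases r u_in
    by (auto simp: dist_sum_leaf[OF S] dist_sum_in[OF S] sum_floating_weight[OF S]
        sum_dist_floating_weight[OF S])
qed

text \<open>The identities of the smaller tree for the root sets \<open>insert u S\<close> and
  \<open>S\<close> are added; the former drop out if \<open>u \<in> S\<close>.\<close>

lemma identities_root:
  assumes S: "S \<subseteq> V" and t: "t \<in> V\<^sub>v" and w: "w \<in> V\<^sub>v"
  shows "(\<Sum>s\<in>insert v S. num_floating V\<^sub>v E\<^sub>v (insert v S - {s}) s w) = num_rooted V\<^sub>v E\<^sub>v (insert v S)"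
    and "(\<Sum>s\<in>insert v S. d' t s * num_floating V\<^sub>v E\<^sub>v (insert v S - {s}) s w) =
       d' t w * num_rooted V\<^sub>v E\<^sub>v (insert v S) - floating_weight V\<^sub>v E\<^sub>v (insert v S) w +
       2 * num_floating V\<^sub>v E\<^sub>v (insert v S) w t"
    and "(\<Sum>s\<in>insert v S. floating_weight V\<^sub>v E\<^sub>v (insert v S - {s}) s) = 2 * num_rooted V\<^sub>v E\<^sub>v (insert v S)"
    and "(\<Sum>s\<in>insert v S. d' t s * floating_weight V\<^sub>v E\<^sub>v (insert v S - {s}) s) =
       forest_sum V\<^sub>v E\<^sub>v (insert v S) + 2 * floating_weight V\<^sub>v E\<^sub>v (insert v S) t"
proof -
  have uS: "insert u S \<subseteq> V" using S u_in by auto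
  have t_cases: "t = v \<or> t \<in> V" and w_cases: "w = v \<or> w \<in> V"
    using t w by auto
  note K_sum = sum_num_floating_root[OF S, of _ "\<lambda>_. 1", simplified]
  note K_sum_leaf = sum_num_floating_root_leaf[OF S, of "\<lambda>_. 1", simplified]
  note B_sum = sum_floating_weight_root[OF S, of "\<lambda>_. 1", simplified]
  note diag = num_floating_diag[OF u_in]
  note zero = num_floating_eq_0[of u "insert u S", simplified]
    num_floating_eq_0[of _ "insert u S" u, simplified]
    num_floating_eq_0[of v "insert v S", simplified]
    num_floating_eq_0[of _ "insert v S" v, simplified]
    floating_weight_eq_0[of u "insert u S", simplified]
    floating_weight_eq_0[of v "insert v S", simplified]
  note sums = sum_num_floating[OF S] sum_num_floating[OF uS]
    sum_dist_num_floating[OF S] sum_dist_num_floating[OF uS]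
    sum_floating_weight[OF S] sum_floating_weight[OF uS]
    sum_dist_floating_weight[OF S] sum_dist_floating_weight[OF uS]
    dist_sum_in[OF S] dist_sum_in[OF uS] dist_sum_leaf[OF S] dist_sum_leaf[OF uS]
  show "(\<Sum>s\<in>insert v S. num_floating V\<^sub>v E\<^sub>v (insert v S - {s}) s w) = num_rooted V\<^sub>v E\<^sub>v (insert v S)"
    using w_cases
    by (auto simp only: K_sum K_sum_leaf mult_1_left sums diag num_rooted_root[OF S] split: if_splits)
  show "(\<Sum>s\<in>insert v S. floating_weight V\<^sub>v E\<^sub>v (insert v S - {s}) s) = 2 * num_rooted V\<^sub>v E\<^sub>v (insert v S)"
    using u_in by (auto simp only: B_sum mult_1_left sums diag num_rooted_root[OF S] split: if_splits, auto)
  have comm: "num_floating V E A x u = num_floating V E A u x" for A x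
    by (rule num_floating_commute)
  show "(\<Sum>s\<in>insert v S. d' t s * num_floating V\<^sub>v E\<^sub>v (insert v S - {s}) s w) =
       d' t w * num_rooted V\<^sub>v E\<^sub>v (insert v S) - floating_weight V\<^sub>v E\<^sub>v (insert v S) w +
       2 * num_floating V\<^sub>v E\<^sub>v (insert v S) w t"
  proof (cases "w = v")
    case True
    \<comment> \<open>Since \<open>v\<close> is a root, the floating terms at \<open>w = v\<close>
      vanish, and both sides are \<open>d' t v\<close> times the number of rooted forests.\<close>
    then show ?thesis using t_cases
      by (simp only: sum_num_floating_root_leaf[OF S] diag num_rooted_root[OF S] zero)
  next
    case False
    then have w: "w \<in> V" using w_cases by auto
    show ?thesis
    proof (cases "t = v")
      case True
      show ?thesis unfolding True zero
        unfolding sum_num_floating_root[OF S w] floating_weight_root[OF S] num_rooted_root[OF S]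
          d'_leaf(1)[OF u_in] d'_leaf(1)[OF w] d'_leaf(3) d_refl
        using w u_in by (simp only: sums comm zero) (simp add: algebra_simps)
    next
      case False
      then have t: "t \<in> V" using t_cases by auto
      show ?thesis
        unfolding sum_num_floating_root[OF S w] floating_weight_root[OF S] num_rooted_root[OF S]
          num_floating_root[OF S] d'_leaf(2)[OF t] d'_in[OF t w] d'_in[OF t u_in]
        using w u_in t by (simp only: sums) (simp add: algebra_simps)
    qed
  qed
  show "(\<Sum>s\<in>insert v S. d' t s * floating_weight V\<^sub>v E\<^sub>v (insert v S - {s}) s) =
       forest_sum V\<^sub>v E\<^sub>v (insert v S) + 2 * floating_weight V\<^sub>v E\<^sub>v (insert v S) t"
  proof (cases "t = v")
    case True
    show ?thesis unfolding True zero
      unfolding sum_floating_weight_root[OF S] forest_sum_root[OF S]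
          d'_leaf(1)[OF u_in] d'_leaf(3) d_refl
      using u_in by (simp only: sums zero d_refl diag) (simp add: algebra_simps)
  next
    case False
    then have t: "t \<in> V" using t_cases by auto
    show ?thesis
      unfolding sum_floating_weight_root[OF S] forest_sum_root[OF S] floating_weight_root[OF S]
         d'_leaf(2)[OF t] d'_in[OF t u_in]
      using u_in t by (simp only: sums) (simp add: algebra_simps)
  qed
qed

lemma forest_identities_leaf: "forest_identities V\<^sub>v E\<^sub>v d'"
  unfolding forest_identities_def
proof (intro allI impI ballI)
  fix S t w assume S: "S \<subseteq> V\<^sub>v" and t: "t \<in> V\<^sub>v" and w: "w \<in> V\<^sub>v"
  show "(\<Sum>s\<in>S. num_floating V\<^sub>v E\<^sub>v (S - {s}) s w) = num_rooted V\<^sub>v E\<^sub>v S \<and>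
     (\<Sum>s\<in>S. d' t s * num_floating V\<^sub>v E\<^sub>v (S - {s}) s w) =
       d' t w * num_rooted V\<^sub>v E\<^sub>v S - floating_weight V\<^sub>v E\<^sub>v S w + 2 * num_floating V\<^sub>v E\<^sub>v S w t \<and>
     (\<Sum>s\<in>S. floating_weight V\<^sub>v E\<^sub>v (S - {s}) s) = 2 * num_rooted V\<^sub>v E\<^sub>v S \<and>
     (\<Sum>s\<in>S. d' t s * floating_weight V\<^sub>v E\<^sub>v (S - {s}) s) =
       forest_sum V\<^sub>v E\<^sub>v S + 2 * floating_weight V\<^sub>v E\<^sub>v S t"
  proof (cases "v \<in> S")
    case True
    then obtain S' where "S = insert v S'" "v \<notin> S'" by (meson Set.set_insert)
    then show ?thesis using identities_root[OF _ t w, of S'] S by blast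
  next
    case False
    then show ?thesis using identities_nonroot[OF _ t w, of S] S by blast
  qed
qed

end

end

text \<open>For \<open>S = {}\<close> the single forest floats with boundary degree
  \<open>0\<close>: \<open>forest_sum\<close> is \<open>- 4\<close>, balanced by twice the weight
  \<open>2\<close>. For \<open>S = {r}\<close>, removing the root leaves weight \<open>2\<close>,
  twice the single rooted forest.\<close>

lemma forest_identities_singleton:
  assumes "d r r = 0"
  shows "forest_identities {r} {} d"
proof -
  have lr: "unrooted {r} {} {} = {r}" "unrooted {r} {r} {} = {}"
    by (auto simp: unrooted_def)
  have "\<delta> (Graph {r} {}) {r} = 0" by (simp add: boundary_degree_def)
  moreover have "is_floating {r} {} {}" "\<not> is_floating {r} {r} {}"
    "is_rooted {r} {r} {}" "\<not> is_rooted {r} {} {}"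
    by (auto simp: is_floating_def is_rooted_def lr separates_def)
  ultimately show ?thesis using assms
    by (auto simp: forest_identities_def subset_singleton_iff num_floating_def num_rooted_def
        floating_weight_def forest_sum_def lr)
qed

section \<open>The bordered distance matrix\<close>

definition dist_mat :: "('a \<Rightarrow> 'a \<Rightarrow> int) \<Rightarrow> 'a list \<Rightarrow> int mat" where
  "dist_mat d xs = mat (length xs) (length xs) (\<lambda>(i, j). d (xs ! i) (xs ! j))"

text \<open>The border occupies index \<open>0\<close>, so \<open>xs ! i\<close> belongs to index
  \<open>Suc i\<close>. With a list instead of a set, a leaf can be replaced in place by its
  neighbour, even if this creates a repetition.\<close>

definition bordered_mat :: "('a \<Rightarrow> 'a \<Rightarrow> int) \<Rightarrow> 'a list \<Rightarrow> int mat" where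
  "bordered_mat d xs = mat (Suc (length xs)) (Suc (length xs))
     (\<lambda>(i, j). if i = 0 \<and> j = 0 then 0 else if i = 0 \<or> j = 0 then 1
               else d (xs ! (i - 1)) (xs ! (j - 1)))"

lemma dim_bordered_mat [simp]:
  "dim_row (bordered_mat d xs) = Suc (length xs)" "dim_col (bordered_mat d xs) = Suc (length xs)"
  by (simp_all add: bordered_mat_def)

lemma bordered_mat_carrier [simp]:
  "bordered_mat d xs \<in> carrier_mat (Suc (length xs)) (Suc (length xs))"
  by (simp add: bordered_mat_def)

lemma bordered_mat_index:
  "i < Suc (length xs) \<Longrightarrow> j < Suc (length xs) \<Longrightarrow>
    bordered_mat d xs $$ (i, j) = (if i = 0 \<and> j = 0 then 0 else if i = 0 \<or> j = 0 then 1
      else d (xs ! (i - 1)) (xs ! (j - 1)))"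
  by (simp add: bordered_mat_def)

lemma bordered_mat_cong:
  assumes "\<And>x y. x \<in> set xs \<Longrightarrow> y \<in> set xs \<Longrightarrow> d x y = d' x y"
  shows "bordered_mat d xs = bordered_mat d' xs"
proof -
  have "d (xs ! (i - 1)) (xs ! (j - 1)) = d' (xs ! (i - 1)) (xs ! (j - 1))"
    if "i < Suc (length xs)" "j < Suc (length xs)" "i \<noteq> 0" "j \<noteq> 0" for i j
    using that by (intro assms nth_mem) auto
  then show ?thesis by (intro eq_matI) (auto simp: bordered_mat_index)
qed

lemma det_bordered_identical:
  assumes "i < length xs" "j < length xs" "i \<noteq> j" "xs ! i = xs ! j"
  shows "det (bordered_mat d xs) = 0"
proof (rule det_identical_rows[of _ "Suc (length xs)" "Suc i" "Suc j"])
  show "row (bordered_mat d xs) (Suc i) = row (bordered_mat d xs) (Suc j)"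
    using assms by (intro eq_vecI) (auto simp: bordered_mat_def)
qed (use assms in auto)

text \<open>Both matrices have the same cofactors along row \<open>k\<close>, so their expansions
  along this row differ in one summand only.\<close>

lemma det_change_entry:
  fixes M N :: "int mat"
  assumes M: "M \<in> carrier_mat n n" and N: "N \<in> carrier_mat n n" and k: "k < n"
    and eq: "\<And>i j. i < n \<Longrightarrow> j < n \<Longrightarrow> (i, j) \<noteq> (k, k) \<Longrightarrow> M $$ (i, j) = N $$ (i, j)"
  shows "det M = det N + (M $$ (k, k) - N $$ (k, k)) * det (mat_delete N k k)"
proof -
  have del: "mat_delete M k j = mat_delete N k j" if "j < n" for j
    using M N k that unfolding mat_delete_def
    by (intro cong_mat) (auto intro!: eq)
  have cof: "cofactor M k j = cofactor N k j" if "j < n" for j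
    using del[OF that] by (simp add: cofactor_def)
  have "det M = (\<Sum>j<n. M $$ (k, j) * cofactor N k j)"
    using laplace_expansion_row[OF M k] cof by simp
  also have "\<dots> = M $$ (k, k) * cofactor N k k + (\<Sum>j\<in>{..<n}-{k}. M $$ (k, j) * cofactor N k j)"
    using k by (simp add: sum.remove)
  also have "(\<Sum>j\<in>{..<n}-{k}. M $$ (k, j) * cofactor N k j) = (\<Sum>j\<in>{..<n}-{k}. N $$ (k, j) * cofactor N k j)"
    using eq[OF k] by (intro sum.cong) auto
  also have "\<dots> = det N - N $$ (k, k) * cofactor N k k"
    using laplace_expansion_row[OF N k] k by (simp add: sum.remove)
  also have "cofactor N k k = det (mat_delete N k k)"
    by (simp add: cofactor_def)
  finally show ?thesis by (simp add: algebra_simps)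
qed

lemma mat_delete_bordered:
  assumes k: "k < length xs"
  shows "mat_delete (bordered_mat d xs) (Suc k) (Suc k) = bordered_mat d (take k xs @ drop (Suc k) xs)"
proof -
  define ys where "ys = take k xs @ drop (Suc k) xs"
  \<comment> \<open>\<open>f\<close> skips the deleted index \<open>Suc k\<close>; the border index
    \<open>0\<close> stays fixed.\<close>
  define f where "f i = (if i < Suc k then i else Suc i)" for i
  have len: "length ys = length xs - 1" using k by (simp add: ys_def)
  have nth: "ys ! i = (if i < k then xs ! i else xs ! Suc i)" if "i < length ys" for i
    using k that unfolding len by (auto simp: ys_def nth_append)
  have f: "f i < Suc (length xs)" "f i = 0 \<longleftrightarrow> i = 0" "i \<noteq> 0 \<Longrightarrow> xs ! (f i - 1) = ys ! (i - 1)"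
    if "i < Suc (length ys)" for i
  proof -
    show "f i < Suc (length xs)" "f i = 0 \<longleftrightarrow> i = 0"
      using that k unfolding len f_def by auto
    assume "i \<noteq> 0"
    then obtain i' where i: "i = Suc i'" by (cases i) auto
    then have "i' < length ys" using that by simp
    from nth[OF this] show "xs ! (f i - 1) = ys ! (i - 1)" unfolding i f_def by simp
  qed
  have "mat_delete (bordered_mat d xs) (Suc k) (Suc k) = bordered_mat d ys"
  proof (rule eq_matI)
    fix i j assume "i < dim_row (bordered_mat d ys)" "j < dim_col (bordered_mat d ys)"
    then have ij: "i < Suc (length ys)" "j < Suc (length ys)"
      by (auto simp: bordered_mat_def)
    then have "mat_delete (bordered_mat d xs) (Suc k) (Suc k) $$ (i, j) = bordered_mat d xs $$ (f i, f j)"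
      using k unfolding len by (auto simp: mat_delete_def bordered_mat_def f_def)
    also have "\<dots> = bordered_mat d ys $$ (i, j)"
      unfolding bordered_mat_index[OF f(1)[OF ij(1)] f(1)[OF ij(2)]] bordered_mat_index[OF ij]
      using f(2,3)[OF ij(1)] f(2,3)[OF ij(2)] by (cases "i = 0"; cases "j = 0") simp_all
    finally show "mat_delete (bordered_mat d xs) (Suc k) (Suc k) $$ (i, j) = bordered_mat d ys $$ (i, j)" .
  qed (use k len in \<open>auto simp: bordered_mat_def mat_delete_def\<close>)
  then show ?thesis by (simp add: ys_def)
qed

text \<open>Subtracting the border row from the row of \<open>v\<close>, and likewise the border
  column, turns distances to \<open>v\<close> into distances to \<open>u\<close>. The result is the
  matrix of \<open>xs[k := u]\<close> except that the diagonal entry is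
  \<open>0 - 1 - 1 = - 2\<close> instead of \<open>0\<close>, and \<open>det_change_entry\<close>
  accounts for this.\<close>

lemma det_bordered_leaf:
  assumes k: "k < length xs" and v: "xs ! k = v" and d: "d v v = 0" "d u u = 0"
    and leaf: "\<And>i. i < length xs \<Longrightarrow> i \<noteq> k \<Longrightarrow>
      d v (xs ! i) = d u (xs ! i) + 1 \<and> d (xs ! i) v = d (xs ! i) u + 1"
  shows "det (bordered_mat d xs) = det (bordered_mat d (xs[k := u])) -
    2 * det (bordered_mat d (take k xs @ drop (Suc k) xs))"
proof -
  let ?n = "Suc (length xs)"
  let ?R = "addrow (- 1) (Suc k) 0 (bordered_mat d xs)"
  let ?M = "addcol (- 1) (Suc k) 0 ?R"
  let ?N = "bordered_mat d (xs[k := u])"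
  have R: "?R \<in> carrier_mat ?n ?n" by (intro carrier_matI) simp_all
  have M: "?M \<in> carrier_mat ?n ?n" by (intro carrier_matI) simp_all
  have N: "?N \<in> carrier_mat ?n ?n" using bordered_mat_carrier[of d "xs[k := u]"] by simp
  have "det ?M = det ?R" by (rule det_addcol[OF _ _ R]) auto
  also have "\<dots> = det (bordered_mat d xs)" by (rule det_addrow) auto
  finally have det_M: "det ?M = det (bordered_mat d xs)" .
  have M_index: "?M $$ (i, j) =
      bordered_mat d xs $$ (i, j) - (if i = Suc k then bordered_mat d xs $$ (0, j) else 0) -
      (if j = Suc k then bordered_mat d xs $$ (i, 0) -
        (if i = Suc k then bordered_mat d xs $$ (0, 0) else 0) else 0)"
    if "i < ?n" "j < ?n" for i j
    using that by simp
  have "det ?M = det ?N + (?M $$ (Suc k, Suc k) - ?N $$ (Suc k, Suc k)) * det (mat_delete ?N (Suc k) (Suc k))"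
  proof (rule det_change_entry[OF M N])
    fix i j assume ij: "i < ?n" "j < ?n" "(i, j) \<noteq> (Suc k, Suc k)"
    have N_index: "?N $$ (i, j) = (if i = 0 \<and> j = 0 then 0 else if i = 0 \<or> j = 0 then 1
      else d (if i = Suc k then u else xs ! (i - 1)) (if j = Suc k then u else xs ! (j - 1)))"
      using ij k by (subst bordered_mat_index) (auto simp: nth_list_update)
    consider "i = 0" | "j = 0" | i' j' where "i = Suc i'" "j = Suc j'" by (cases i; cases j) auto
    then show "?M $$ (i, j) = ?N $$ (i, j)"
    proof cases
      case 3
      then have "i' < length xs" "j' < length xs" "i' \<noteq> k \<or> j' \<noteq> k" using ij by auto
      then show ?thesis unfolding M_index[OF ij(1,2)] N_index 3
        using leaf[of i'] leaf[of j'] v by (cases "i' = k"; cases "j' = k") (simp_all add: bordered_mat_index)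
    qed (use ij in \<open>simp_all add: M_index N_index bordered_mat_index\<close>)
  qed (use k in auto)
  moreover have "?M $$ (Suc k, Suc k) = -2" "?N $$ (Suc k, Suc k) = 0"
    using k v d by (simp_all add: M_index bordered_mat_index)
  moreover have "mat_delete ?N (Suc k) (Suc k) = bordered_mat d (take k xs @ drop (Suc k) xs)"
    using mat_delete_bordered[of k "xs[k := u]" d] k by simp
  ultimately have "det (bordered_mat d xs) =
      det ?N + (- 2 - 0) * det (bordered_mat d (take k xs @ drop (Suc k) xs))"
    by (simp only: det_M)
  then show ?thesis by simp
qed

lemma det_bordered_cramer:
  assumes "(\<Sum>i<length xs. \<mu> i) = a"
    and "\<And>i. i < length xs \<Longrightarrow> (\<Sum>j<length xs. d (xs ! i) (xs ! j) * \<mu> j) = b"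
  shows "- b * det (bordered_mat d xs) = a * det (dist_mat d xs)"
proof -
  let ?n = "length xs" and ?N = "bordered_mat d xs"
  define x where "x = vec (Suc ?n) (\<lambda>i. if i = 0 then - b else \<mu> (i - 1))"
  have x: "x \<in> carrier_vec (Suc ?n)" by (simp add: x_def)
  have Nx: "(?N *\<^sub>v x) $ i = (if i = 0 then a else 0)" if "i < Suc ?n" for i
  proof -
    have "(?N *\<^sub>v x) $ i = (\<Sum>j<Suc ?n. ?N $$ (i, j) * x $ j)"
      using that x by (simp add: scalar_prod_def bordered_mat_def lessThan_atLeast0)
    also have "\<dots> = ?N $$ (i, 0) * - b + (\<Sum>j<?n. ?N $$ (i, Suc j) * \<mu> j)"
      unfolding sum.lessThan_Suc_shift by (simp add: x_def)
    also have "\<dots> = (if i = 0 then a else 0)"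
      using that assms(1) assms(2)[of "i - 1"] by (cases i) (auto simp: bordered_mat_def)
    finally show ?thesis .
  qed
  \<comment> \<open>Column \<open>0\<close> of \<open>?R\<close> is \<open>(a, 0, ..., 0)\<close>,
    so expanding along it leaves \<open>a\<close> times the determinant without border; by Cramer's
    lemma the same determinant is \<open>x $ 0 = - b\<close> times \<open>det ?N\<close>.\<close>
  let ?R = "replace_col ?N (?N *\<^sub>v x) 0"
  have R: "?R \<in> carrier_mat (Suc ?n) (Suc ?n)" by (simp add: replace_col_def bordered_mat_def)
  have col: "?R $$ (i, 0) = (if i = 0 then a else 0)" if "i < Suc ?n" for i
    using that Nx[OF that] by (simp add: replace_col_def bordered_mat_def)
  have "mat_delete ?R 0 0 = dist_mat d xs"
    by (rule eq_matI) (auto simp: mat_delete_def replace_col_def bordered_mat_def dist_mat_def)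
  then have "cofactor ?R 0 0 = det (dist_mat d xs)" by (simp add: cofactor_def)
  moreover have "det ?R = (\<Sum>i<Suc ?n. ?R $$ (i, 0) * cofactor ?R i 0)"
    by (rule laplace_expansion_column[OF R]) simp
  then have "det ?R = ?R $$ (0, 0) * cofactor ?R 0 0"
    unfolding sum.lessThan_Suc_shift using col by simp
  moreover have "?R $$ (0, 0) = a" using col by simp
  moreover have "det ?R = x $ 0 * det ?N"
    by (rule cramer_lemma_mat[OF _ x]) auto
  ultimately show ?thesis by (simp add: x_def)
qed

section \<open>Paths and distances in trees\<close>

lemma is_path_rev: "is_path G a p b \<longleftrightarrow> is_path G b (rev p) a"
proof -
  have swap: "(\<lambda>x y. {y, x} \<in> edges G) = (\<lambda>x y. {x, y} \<in> edges G)"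
    by (intro ext) (simp only: insert_commute)
  have "is_path G b (rev p) a" if "is_path G a p b" for a p b
    using that unfolding is_path_def successively_rev swap by (simp add: hd_rev last_rev)
  from this[of a p b] this[of b "rev p" a] show ?thesis by auto
qed

lemma is_path_self: "is_path G a p a \<longleftrightarrow> p = [a] \<and> a \<in> verts G"
proof
  assume p: "is_path G a p a"
  then obtain q where q: "p = a # q" by (cases p) (auto simp: is_path_def)
  with p have "q = []" by (cases q rule: rev_cases) (auto simp: is_path_def)
  with p q show "p = [a] \<and> a \<in> verts G" by (auto simp: is_path_def)
qed (auto simp: is_path_def)

text \<open>This makes the definite description in \<open>tree_dist\<close> meaningful, and it is
  inherited when a leaf is attached.\<close>

definition unique_paths :: "'a graph \<Rightarrow> bool" where
  "unique_paths G \<longleftrightarrow> (\<forall>a\<in>verts G. \<forall>b\<in>verts G. \<exists>!p. is_path G a p b)"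

lemma tree_dist_self: "a \<in> verts G \<Longrightarrow> tree_dist G a a = 0"
  by (simp add: tree_dist_def is_path_self)

lemma tree_dist_commute:
  assumes "unique_paths G" "a \<in> verts G" "b \<in> verts G"
  shows "tree_dist G a b = tree_dist G b a"
proof -
  obtain p where p: "is_path G a p b" "\<And>q. is_path G a q b \<Longrightarrow> q = p"
    using assms unfolding unique_paths_def by metis
  have "(THE q. is_path G a q b) = p" using p by (rule the_equality)
  moreover have "(THE q. is_path G b q a) = rev p"
  proof (rule the_equality)
    show "is_path G b (rev p) a" using p(1) is_path_rev by metis
    show "q = rev p" if "is_path G b q a" for q
    proof -
      have "is_path G a (rev q) b" using that is_path_rev by metis
      from p(2)[OF this] show ?thesis by auto
    qed
  qed
  ultimately show ?thesis by (simp add: tree_dist_def)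
qed

section \<open>Paths after attaching a leaf\<close>

context leaf_extension
begin

text \<open>A path through \<open>v\<close> with both ends in \<open>V\<close> would enter and leave
  \<open>v\<close> by its only neighbour \<open>u\<close>, and so visit \<open>u\<close>
  twice.\<close>

lemma is_path_in:
  assumes "a \<in> V" "b \<in> V"
  shows "is_path (Graph V\<^sub>v E\<^sub>v) a p b \<longleftrightarrow> is_path (Graph V E) a p b"
proof
  assume p: "is_path (Graph V\<^sub>v E\<^sub>v) a p b"
  have "v \<notin> set p"
  proof
    assume "v \<in> set p"
    then obtain xs ys where s: "p = xs @ v # ys" by (meson split_list)
    have "xs \<noteq> []" "ys \<noteq> []"
      using p s assms v_notin by (auto simp: is_path_def)
    with p s have "{last xs, v} \<in> E\<^sub>v" "{v, hd ys} \<in> E\<^sub>v"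
      by (auto simp: is_path_def successively_append_iff successively_Cons)
    then have "last xs = u" "hd ys = u"
      using edge_notin by (auto simp: doubleton_eq_iff)
    then have "u \<in> set xs" "u \<in> set ys"
      using \<open>xs \<noteq> []\<close> \<open>ys \<noteq> []\<close> last_in_set hd_in_set by metis+
    then show False using p s by (auto simp: is_path_def)
  qed
  then have "set p \<subseteq> V" using p by (auto simp: is_path_def)
  moreover have "successively (\<lambda>x y. {x, y} \<in> E) p"
    using p \<open>v \<notin> set p\<close> unfolding is_path_def
    by (auto elim!: successively_mono simp: doubleton_eq_iff)
  ultimately show "is_path (Graph V E) a p b" using p by (auto simp: is_path_def)
next
  assume "is_path (Graph V E) a p b"
  then show "is_path (Graph V\<^sub>v E\<^sub>v) a p b"
    by (auto simp: is_path_def elim!: successively_mono)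
qed

lemma is_path_leaf:
  assumes "b \<in> V"
  shows "is_path (Graph V\<^sub>v E\<^sub>v) v p b \<longleftrightarrow> (\<exists>q. p = v # q \<and> is_path (Graph V E) u q b)"
proof
  assume p: "is_path (Graph V\<^sub>v E\<^sub>v) v p b"
  then obtain q where q: "p = v # q" by (cases p) (auto simp: is_path_def)
  moreover have "q \<noteq> []" using p q assms v_notin by (auto simp: is_path_def)
  ultimately have "{v, hd q} \<in> E\<^sub>v" using p by (auto simp: is_path_def successively_Cons)
  then have "hd q = u" using edge_notin by (auto simp: doubleton_eq_iff)
  then have "is_path (Graph V\<^sub>v E\<^sub>v) u q b"
    using p q \<open>q \<noteq> []\<close> by (auto simp: is_path_def successively_Cons)
  then show "\<exists>q. p = v # q \<and> is_path (Graph V E) u q b"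
    using q is_path_in[OF u_in assms] by auto
next
  assume "\<exists>q. p = v # q \<and> is_path (Graph V E) u q b"
  then obtain q where q: "p = v # q" "is_path (Graph V E) u q b" by auto
  then have "is_path (Graph V\<^sub>v E\<^sub>v) u q b" using is_path_in[OF u_in assms] by auto
  then show "is_path (Graph V\<^sub>v E\<^sub>v) v p b"
    using q v_notin by (auto simp: is_path_def successively_Cons insert_commute)
qed

context
  assumes unique: "unique_paths (Graph V E)"
begin

lemma unique_path:
  assumes "a \<in> V" "b \<in> V"
  obtains p where "is_path (Graph V E) a p b" "\<And>q. is_path (Graph V E) a q b \<Longrightarrow> q = p"
proof -
  have "\<exists>!p. is_path (Graph V E) a p b" using assms unique by (simp add: unique_paths_def)
  then show ?thesis using that by blast
qed

lemma unique_path_leaf: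
  assumes "b \<in> V"
  shows "\<exists>!p. is_path (Graph V\<^sub>v E\<^sub>v) v p b"
proof -
  obtain p where "is_path (Graph V E) u p b" "\<And>q. is_path (Graph V E) u q b \<Longrightarrow> q = p"
    using unique_path[OF u_in assms] by metis
  then show ?thesis unfolding is_path_leaf[OF assms] by (intro ex1I[of _ "v # p"]) blast+
qed

lemma unique_paths_leaf: "unique_paths (Graph V\<^sub>v E\<^sub>v)"
  unfolding unique_paths_def
proof (intro ballI)
  fix a b assume "a \<in> verts (Graph V\<^sub>v E\<^sub>v)" "b \<in> verts (Graph V\<^sub>v E\<^sub>v)"
  then consider "a = v" "b = v" | "a = v" "b \<in> V" | "a \<in> V" "b = v" | "a \<in> V" "b \<in> V"
    by auto
  then show "\<exists>!p. is_path (Graph V\<^sub>v E\<^sub>v) a p b"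
  proof cases
    case 1
    then show ?thesis by (auto simp: is_path_self)
  next
    case 2
    then show ?thesis using unique_path_leaf by auto
  next
    case 3
    with unique_path_leaf obtain p where p: "is_path (Graph V\<^sub>v E\<^sub>v) v p a"
      "\<And>q. is_path (Graph V\<^sub>v E\<^sub>v) v q a \<Longrightarrow> q = p" by metis
    show ?thesis
    proof
      show "is_path (Graph V\<^sub>v E\<^sub>v) a (rev p) b" using 3 p(1) is_path_rev by metis
      show "q = rev p" if "is_path (Graph V\<^sub>v E\<^sub>v) a q b" for q
      proof -
        have "is_path (Graph V\<^sub>v E\<^sub>v) v (rev q) a" using that 3 is_path_rev by metis
        from p(2)[OF this] show ?thesis by auto
      qed
    qed
  next
    case 4
    then show ?thesis using unique by (auto simp: is_path_in unique_paths_def)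
  qed
qed

lemma tree_dist_in: "a \<in> V \<Longrightarrow> b \<in> V \<Longrightarrow> tree_dist (Graph V\<^sub>v E\<^sub>v) a b = tree_dist (Graph V E) a b"
  by (simp add: tree_dist_def is_path_in)

lemma tree_dist_leaf:
  assumes "b \<in> V"
  shows "tree_dist (Graph V\<^sub>v E\<^sub>v) v b = tree_dist (Graph V E) u b + 1"
    and "tree_dist (Graph V\<^sub>v E\<^sub>v) b v = tree_dist (Graph V E) b u + 1"
proof -
  obtain p where p: "is_path (Graph V E) u p b" "\<And>q. is_path (Graph V E) u q b \<Longrightarrow> q = p"
    using unique_path[OF u_in assms] by metis
  then have "(THE q. is_path (Graph V E) u q b) = p" by (rule the_equality)
  moreover have "(THE q. is_path (Graph V\<^sub>v E\<^sub>v) v q b) = v # p"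
    unfolding is_path_leaf[OF assms]
  proof (rule the_equality)
    show "\<exists>q. v # p = v # q \<and> is_path (Graph V E) u q b" using p(1) by simp
    fix r assume "\<exists>q. r = v # q \<and> is_path (Graph V E) u q b"
    then obtain q where q: "r = v # q" "is_path (Graph V E) u q b" by blast
    show "r = v # p" unfolding q(1) p(2)[OF q(2)] ..
  qed
  \<comment> \<open>Subtraction on \<open>nat\<close> truncates, so
    \<open>length p - 1 + 1 = length p\<close> requires a nonempty \<open>p\<close>.\<close>
  moreover have "length p > 0" using p(1) by (auto simp: is_path_def)
  ultimately show *: "tree_dist (Graph V\<^sub>v E\<^sub>v) v b = tree_dist (Graph V E) u b + 1"
    by (simp add: tree_dist_def)
  show "tree_dist (Graph V\<^sub>v E\<^sub>v) b v = tree_dist (Graph V E) b u + 1"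
    using * tree_dist_commute[OF unique_paths_leaf, of b v] tree_dist_commute[OF unique, of b u]
      assms u_in by simp
qed

end

end

section \<open>Trees grown by attaching leaves\<close>

inductive built_tree :: "'a set \<Rightarrow> 'a set set \<Rightarrow> bool" where
  singleton: "built_tree {r} {}"
| leaf: "built_tree V E \<Longrightarrow> u \<in> V \<Longrightarrow> v \<notin> V \<Longrightarrow> built_tree (insert v V) (insert {u, v} E)"

lemma built_tree_finite: "built_tree V E \<Longrightarrow> finite V \<and> (\<forall>e\<in>E. e \<subseteq> V)"
  by (induction rule: built_tree.induct) auto

lemma built_tree_leaf_extension:
  "built_tree V E \<Longrightarrow> u \<in> V \<Longrightarrow> v \<notin> V \<Longrightarrow> leaf_extension V E u v"
  using built_tree_finite by unfold_locales auto

lemma built_tree_unique_paths: "built_tree V E \<Longrightarrow> unique_paths (Graph V E)"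
proof (induction rule: built_tree.induct)
  case (singleton r)
  then show ?case by (auto simp: unique_paths_def is_path_self)
next
  case (leaf V E u v)
  interpret leaf_extension V E u v using leaf by (intro built_tree_leaf_extension)
  show ?case using leaf.IH by (rule unique_paths_leaf)
qed

abbreviation int_dist :: "'a set \<Rightarrow> 'a set set \<Rightarrow> 'a \<Rightarrow> 'a \<Rightarrow> int" where
  "int_dist V E a b \<equiv> int (tree_dist (Graph V E) a b)"

lemma built_tree_forest_identities:
  "built_tree V E \<Longrightarrow> forest_identities V E (int_dist V E)"
proof (induction rule: built_tree.induct)
  case (singleton r)
  show ?case by (rule forest_identities_singleton) (simp add: tree_dist_self)
next
  case (leaf V E u v)
  interpret leaf_extension V E u v using leaf by (intro built_tree_leaf_extension)
  note unique = built_tree_unique_paths[OF leaf.hyps(1)]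
  show ?case
    by (rule forest_identities_leaf[where d = "int_dist V E"])
      (use leaf.IH u_in in \<open>simp_all add: tree_dist_in[OF unique] tree_dist_leaf[OF unique] tree_dist_self\<close>)
qed

section \<open>Rooted forests and the bordered determinant\<close>

lemma num_rooted_nonneg: "0 \<le> num_rooted V E S"
  by (auto simp: num_rooted_def intro!: sum_nonneg)

lemma num_rooted_singleton: "num_rooted {r} {} {} = 0" "num_rooted {r} {} {r} = 1"
  by (auto simp: num_rooted_def is_rooted_def unrooted_def separates_def)

text \<open>Allows the count to be cancelled at the end. If the leaf is a root, one of the
  nonnegative summands in \<open>num_rooted_root\<close> is positive by induction: that of
  \<open>{u}\<close> if \<open>v\<close> is the only root, otherwise that of the remaining
  roots.\<close>

lemma built_tree_num_rooted_pos:
  "built_tree V E \<Longrightarrow> S \<subseteq> V \<Longrightarrow> S \<noteq> {} \<Longrightarrow> num_rooted V E S > 0"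
proof (induction arbitrary: S rule: built_tree.induct)
  case (singleton r)
  then have "S = {r}" by auto
  then show ?case by (simp add: num_rooted_singleton)
next
  case (leaf V E u v)
  interpret leaf_extension V E u v using leaf.hyps by (intro built_tree_leaf_extension)
  show ?case
  proof (cases "v \<in> S")
    case True
    then obtain R where R: "S = insert v R" "v \<notin> R" by (meson Set.set_insert)
    then have RV: "R \<subseteq> V" using leaf.prems by auto
    show ?thesis
    proof (cases "R = {}")
      case True
      then show ?thesis using leaf.IH[of "{u}"] R u_in num_rooted_nonneg[of V E "{}"]
        by (simp add: num_rooted_root)
    next
      case False
      then show ?thesis using leaf.IH[OF RV] R num_rooted_nonneg[of V E "insert u R"]
        by (simp add: num_rooted_root[OF RV])
    qed
  next
    case False
    then have "S \<subseteq> V" using leaf.prems by auto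
    then show ?thesis using leaf.IH leaf.prems by (simp add: num_rooted_nonroot)
  qed
qed

text \<open>If the leaf occurs in \<open>xs\<close>, \<open>det_bordered_leaf\<close> and
  \<open>num_rooted_root\<close> are the same recursion: replacing \<open>v\<close> by
  \<open>u\<close> keeps the length, deleting \<open>v\<close> accounts for one factor
  \<open>- 2\<close>. Otherwise neither side changes.\<close>

lemma det_bordered_eq_num_rooted:
  "built_tree V E \<Longrightarrow> distinct xs \<Longrightarrow> set xs \<subseteq> V \<Longrightarrow>
    2 * det (bordered_mat (int_dist V E) xs) = (- 2) ^ length xs * num_rooted V E (set xs)"
proof (induction arbitrary: xs rule: built_tree.induct)
  case (singleton r)
  then have "xs = [] \<or> xs = [r]"
    by (cases xs; cases "tl xs") auto
  then show ?case
  proof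
    assume xs: "xs = []"
    have "det (bordered_mat (int_dist {r} {}) []) = 0"
      using laplace_expansion_row[OF bordered_mat_carrier[of "int_dist {r} {}" "[]"], of 0]
      by (simp add: bordered_mat_index)
    then show ?thesis by (simp add: xs num_rooted_singleton)
  next
    assume xs: "xs = [r]"
    let ?N = "bordered_mat (int_dist {r} {}) [r]"
    have "det ?N = (\<Sum>j<Suc (Suc 0). ?N $$ (0, j) * cofactor ?N 0 j)"
      using laplace_expansion_row[OF bordered_mat_carrier[of "int_dist {r} {}" "[r]"], of 0] by simp
    also have "\<dots> = - det (mat_delete ?N 0 1)"
      by (simp add: bordered_mat_index cofactor_def)
    also have "det (mat_delete ?N 0 1) = 1"
      by (subst det_single) (simp_all add: mat_delete_def bordered_mat_def)
    finally have "det ?N = -1" .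
    then show ?thesis by (simp add: xs num_rooted_singleton)
  qed
next
  case (leaf V E u v)
  interpret leaf_extension V E u v using leaf.hyps by (intro built_tree_leaf_extension)
  note unique = built_tree_unique_paths[OF leaf.hyps(1)]
  let ?d = "int_dist V E" and ?d' = "int_dist V\<^sub>v E\<^sub>v"
  have cong: "bordered_mat ?d' ys = bordered_mat ?d ys" if "set ys \<subseteq> V" for ys
    using that by (intro bordered_mat_cong) (auto simp: tree_dist_in[OF unique] subset_eq)
  show ?case
  proof (cases "v \<in> set xs")
    case False
    then have "set xs \<subseteq> V" using leaf.prems by auto
    then show ?thesis using leaf.IH leaf.prems by (simp add: num_rooted_nonroot cong)
  next
    case True
    then obtain as bs where xs: "xs = as @ v # bs" by (meson split_list)
    define k where "k = length as"
    have k: "k < length xs" "xs ! k = v" by (auto simp: xs k_def)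
    have zs: "take k xs @ drop (Suc k) xs = as @ bs" by (simp add: xs k_def)
    have ys: "xs[k := u] = as @ u # bs" by (simp add: xs k_def)
    have S: "set (as @ bs) \<subseteq> V" "distinct (as @ bs)" "set xs = insert v (set (as @ bs))"
      using leaf.prems by (auto simp: xs)
    have "det (bordered_mat ?d' xs) = det (bordered_mat ?d' (as @ u # bs)) - 2 * det (bordered_mat ?d' (as @ bs))"
      unfolding zs[symmetric] ys[symmetric]
    proof (rule det_bordered_leaf[OF k])
      show "?d' v v = 0" "?d' u u = 0" using u_in by (simp_all add: tree_dist_self)
      fix i assume i: "i < length xs" "i \<noteq> k"
      then have "xs ! i \<noteq> v" using k leaf.prems(1) nth_eq_iff_index_eq by metis
      then have "xs ! i \<in> V" using i leaf.prems(2) nth_mem by blast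
      then show "?d' v (xs ! i) = ?d' u (xs ! i) + 1 \<and> ?d' (xs ! i) v = ?d' (xs ! i) u + 1"
        using u_in by (simp add: tree_dist_in[OF unique] tree_dist_leaf[OF unique])
    qed
    also have "bordered_mat ?d' (as @ bs) = bordered_mat ?d (as @ bs)"
      by (rule cong[OF S(1)])
    also have "bordered_mat ?d' (as @ u # bs) = bordered_mat ?d (as @ u # bs)"
      using S(1) u_in by (intro cong) auto
    finally have rec: "2 * det (bordered_mat ?d' xs) =
      2 * det (bordered_mat ?d (as @ u # bs)) - 2 * (2 * det (bordered_mat ?d (as @ bs)))" by simp
    have len: "length xs = Suc (length (as @ bs))" by (simp add: xs)
    \<comment> \<open>If \<open>u\<close> is listed already, the new list repeats it and two rows
      agree, which matches the \<open>0\<close> in \<open>num_rooted_root\<close>.\<close>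
    have u: "2 * det (bordered_mat ?d (as @ u # bs)) =
      (if u \<in> set (as @ bs) then 0 else (- 2) ^ length xs * num_rooted V E (insert u (set (as @ bs))))"
    proof (cases "u \<in> set (as @ bs)")
      case True
      have "\<exists>i < length xs. i \<noteq> k \<and> (as @ u # bs) ! i = u"
      proof (cases "u \<in> set as")
        case True
        then obtain i where "i < length as" "as ! i = u" by (metis in_set_conv_nth)
        then show ?thesis by (intro exI[of _ i]) (auto simp: k_def xs nth_append)
      next
        case False
        with True have "u \<in> set bs" by auto
        then obtain i where "i < length bs" "bs ! i = u" by (metis in_set_conv_nth)
        then show ?thesis by (intro exI[of _ "Suc k + i"]) (auto simp: k_def xs nth_append)
      qed
      then obtain i where "i < length xs" "i \<noteq> k" "(as @ u # bs) ! i = u" by blast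
      then have "det (bordered_mat ?d (as @ u # bs)) = 0"
        by (intro det_bordered_identical[of i _ k]) (auto simp: xs k_def)
      with True show ?thesis by simp
    next
      case False
      then have "2 * det (bordered_mat ?d (as @ u # bs)) =
        (- 2) ^ length (as @ u # bs) * num_rooted V E (set (as @ u # bs))"
        using S u_in by (intro leaf.IH) auto
      moreover have "length (as @ u # bs) = length xs"
        "set (as @ u # bs) = insert u (set (as @ bs))" by (auto simp: xs)
      ultimately show ?thesis using False by (simp only: if_False)
    qed
    show ?thesis
      unfolding rec u S(3) num_rooted_root[OF S(1)] leaf.IH[OF S(2,1)] len
      by (simp add: algebra_simps)
  qed
qed

section \<open>Every tree arises by attaching leaves\<close>

lemma successively_leaves_set:
  assumes "successively P p" "p \<noteq> []" "hd p \<in> W" "last p \<notin> W"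
  shows "\<exists>a b. a \<in> W \<and> b \<notin> W \<and> b \<in> set p \<and> P a b"
  using assms
proof (induction p)
  case (Cons x p)
  then have "p \<noteq> []" by auto
  show ?case
  proof (cases "hd p \<in> W")
    case True
    with Cons \<open>p \<noteq> []\<close> show ?thesis by (auto simp: successively_Cons)
  next
    case False
    then have "x \<in> W \<and> hd p \<notin> W \<and> hd p \<in> set (x # p) \<and> P x (hd p)"
      using Cons.prems \<open>p \<noteq> []\<close> by (auto simp: successively_Cons)
    then show ?thesis by blast
  qed
qed simp

text \<open>Take a maximal vertex set \<open>W\<close> whose induced subgraph can be built. If a
  vertex were missing, connectivity would give an edge from \<open>W\<close> to some
  \<open>b\<close> outside, and acyclicity would make it the only one to \<open>b\<close>; attaching
  \<open>b\<close> as a leaf would contradict maximality.\<close>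

lemma built_tree_if_is_tree:
  assumes T: "is_tree T"
  shows "built_tree (verts T) (edges T)"
proof -
  define induced where "induced W = {e \<in> edges T. e \<subseteq> W}" for W
  define \<W> where "\<W> = {W. W \<subseteq> verts T \<and> built_tree W (induced W)}"
  have edges: "e \<subseteq> verts T" "card e = 2" if "e \<in> edges T" for e
    using T that by (auto simp: is_tree_def simple_graph_def)
  have "finite (verts T)" using T by (auto simp: is_tree_def simple_graph_def)
  then have "finite \<W>" by (auto simp: \<W>_def)
  moreover obtain r where r: "r \<in> verts T"
    using T by (auto simp: is_tree_def connected_graph_def)
  moreover have "induced {r} = {}"
    using edges(2) by (fastforce simp: induced_def subset_singleton_iff)
  then have "{r} \<in> \<W>" using r built_tree.singleton by (auto simp: \<W>_def)
  ultimately obtain W where W: "W \<in> \<W>" and max: "\<And>W'. W' \<in> \<W> \<Longrightarrow> W \<subseteq> W' \<Longrightarrow> W = W'"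
    using finite_has_maximal[of \<W>] by blast
  have bW: "built_tree W (induced W)" and sub: "W \<subseteq> verts T" using W by (auto simp: \<W>_def)
  have "W \<noteq> {}" using bW by (auto elim: built_tree.cases)
  have "W = verts T"
  proof (rule ccontr)
    assume "W \<noteq> verts T"
    then obtain x y where "x \<in> W" "y \<in> verts T" "y \<notin> W" using sub \<open>W \<noteq> {}\<close> by blast
    moreover from this obtain p where "is_path T x p y"
      using T sub unfolding is_tree_def connected_graph_def by blast
    ultimately obtain a b where ab: "a \<in> W" "b \<notin> W" "{a, b} \<in> edges T" and "b \<in> set p"
      using successively_leaves_set[of "\<lambda>x y. {x, y} \<in> edges T" p W] by (auto simp: is_path_def)
    then have b: "b \<in> verts T" using edges by blast
    have only: "c = a" if c: "c \<in> W" "{b, c} \<in> edges T" for c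
    proof (rule ccontr)
      assume "c \<noteq> a"
      obtain q where q: "is_path (Graph W (induced W)) a q c"
        using built_tree_unique_paths[OF bW] ab(1) c(1) by (fastforce simp: unique_paths_def)
      \<comment> \<open>A cycle needs three vertices: \<open>b\<close> and at least two on the path
        from \<open>a\<close> to \<open>c\<close> inside \<open>W\<close>.\<close>
      have "length q \<ge> 2"
        using q \<open>c \<noteq> a\<close> by (cases q; cases "tl q") (auto simp: is_path_def)
      moreover have "successively (\<lambda>x y. {x, y} \<in> edges T) q"
        using q by (auto simp: is_path_def induced_def elim!: successively_mono)
      ultimately have "is_cycle T (b # q)"
        using q ab c b sub by (auto simp: is_cycle_def is_path_def successively_Cons insert_commute)
      then show False using T by (auto simp: is_tree_def acyclic_graph_def)
    qed
    have "e \<in> insert {a, b} (induced W)" if "e \<in> induced (insert b W)" for e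
    proof (cases "b \<in> e")
      case True
      from that have e: "e \<in> edges T" "e \<subseteq> insert b W" by (auto simp: induced_def)
      then obtain c where c: "e = {b, c}" "c \<noteq> b"
        using edges(2)[OF e(1)] True by (auto simp: card_2_iff)
      then show ?thesis using only[of c] e by auto
    qed (use that in \<open>auto simp: induced_def\<close>)
    then have "induced (insert b W) = insert {a, b} (induced W)"
      using ab by (auto simp: induced_def)
    then have "insert b W \<in> \<W>"
      using built_tree.leaf[OF bW ab(1,2)] b sub by (auto simp: \<W>_def)
    from max[OF this] ab(2) show False by auto
  qed
  moreover have "induced (verts T) = edges T" using edges by (auto simp: induced_def)
  ultimately show ?thesis using bW by simp
qed

section \<open>Components of spanning forests\<close>

lemma linked_if_is_path: "is_path (Graph V F) a p b \<Longrightarrow> linked F a b"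
proof (induction p arbitrary: a)
  case (Cons x p)
  show ?case
  proof (cases "p = []")
    case False
    with Cons.prems have "is_path (Graph V F) (hd p) p b" "{a, hd p} \<in> F"
      by (auto simp: is_path_def successively_Cons)
    then show ?thesis using Cons.IH linked_edge linked_trans by metis
  qed (use Cons.prems in \<open>auto simp: is_path_def\<close>)
qed (simp add: is_path_def)

text \<open>A step to a new vertex extends the path; a step to a visited one cuts it back to that
  vertex.\<close>

lemma is_path_if_linked:
  assumes "linked F a b" "a \<in> V" "\<And>e. e \<in> F \<Longrightarrow> e \<subseteq> V"
  shows "\<exists>p. is_path (Graph V F) a p b"
  using assms(1)
proof (induction rule: linked_induct)
  case refl
  show ?case using assms(2) by (auto intro!: exI[of _ "[a]"] simp: is_path_def)
next
  case (step y z)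
  then obtain p where p: "is_path (Graph V F) a p y" by auto
  have z: "z \<in> V" using assms(3) step by auto
  show ?case
  proof (cases "z \<in> set p")
    case True
    then obtain xs ys where s: "p = xs @ z # ys" by (meson split_list)
    then have "is_path (Graph V F) a (xs @ [z]) z"
      using p by (cases xs) (auto simp: is_path_def successively_append_iff successively_Cons hd_append)
    then show ?thesis by blast
  next
    case False
    then have "is_path (Graph V F) a (p @ [z]) z"
      using p step z by (auto simp: is_path_def successively_append_iff)
    then show ?thesis by blast
  qed
qed

lemma components_eq:
  assumes "\<And>e. e \<in> F \<Longrightarrow> e \<subseteq> V"
  shows "components (Graph V F) = (\<lambda>a. {b. linked F a b}) ` V"
proof -
  have "(\<exists>p. is_path (Graph V F) a p b) \<longleftrightarrow> linked F a b" if "a \<in> V" for a b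
    using is_path_if_linked[OF _ that assms] linked_if_is_path by metis
  then show ?thesis unfolding components_def by (auto intro!: image_cong)
qed

lemma linked_class_eq_iff: "{c. linked F a c} = {c. linked F b c} \<longleftrightarrow> linked F a b"
proof
  assume "{c. linked F a c} = {c. linked F b c}"
  then have "b \<in> {c. linked F a c}" by simp
  then show "linked F a b" by simp
next
  assume "linked F a b"
  then show "{c. linked F a c} = {c. linked F b c}"
    using linked_sym[of F] linked_trans[of F] by blast
qed

lemma inj_on_linked_class: "inj_on (\<lambda>a. {b. linked F a b}) S \<longleftrightarrow> separates F S"
  by (simp add: inj_on_def separates_def linked_class_eq_iff)

text \<open>One root per component means that every vertex reaches a root and distinct roots are not
  linked. Conversely the roots then index the components, which gives their number.\<close>

lemma is_rooted_iff:
  assumes "finite S" "S \<subseteq> V" and F: "\<And>e. e \<in> F \<Longrightarrow> e \<subseteq> V"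
  shows "card (components (Graph V F)) = card S \<and> (\<forall>C\<in>components (Graph V F). card (C \<inter> S) = 1)
    \<longleftrightarrow> is_rooted V S F" (is "?l \<longleftrightarrow> ?r")
proof
  let ?c = "\<lambda>a. {b. linked F a b}"
  assume ?l
  then have one: "card (?c a \<inter> S) = 1" if "a \<in> V" for a
    using that by (simp add: components_eq[OF F])
  have "s = t" if "s \<in> S" "t \<in> S" "linked F s t" for s t
  proof -
    have "s \<in> ?c s \<inter> S" "t \<in> ?c s \<inter> S" using that by auto
    moreover have "s \<in> V" using that assms(2) by blast
    from one[OF this] obtain x where "?c s \<inter> S = {x}" by (rule card_1_singletonE)
    ultimately show ?thesis by auto
  qed
  moreover have "\<exists>s\<in>S. linked F a s" if "a \<in> V" for a
  proof -
    from one[OF that] obtain s where "?c a \<inter> S = {s}" by (rule card_1_singletonE)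
    then show ?thesis by blast
  qed
  ultimately show ?r by (auto simp: is_rooted_def separates_def unrooted_def)
next
  let ?c = "\<lambda>a. {b. linked F a b}"
  assume r: ?r
  then have root: "\<exists>s\<in>S. linked F a s" if "a \<in> V" for a
    using that by (auto simp: is_rooted_def unrooted_def)
  then have "?c ` V = ?c ` S" using assms(2) linked_class_eq_iff[of F] by (fastforce simp: image_iff)
  then have "card (components (Graph V F)) = card S"
    using r by (simp add: components_eq[OF F] card_image inj_on_linked_class is_rooted_def)
  moreover have "card (?c a \<inter> S) = 1" if a: "a \<in> V" for a
  proof -
    obtain s where s: "s \<in> S" "linked F a s" using root[OF a] by auto
    have "t = s" if t: "t \<in> S" "linked F a t" for t
    proof -
      have "linked F t s" using t(2) s(2) linked_sym linked_trans by metis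
      then show ?thesis using r t(1) s(1) by (simp add: is_rooted_def separates_def)
    qed
    then have "?c a \<inter> S = {s}" using s by blast
    then show ?thesis by simp
  qed
  ultimately show ?l by (simp add: components_eq[OF F])
qed

text \<open>A vertex linked to an unrooted one is unrooted, and in a floating forest all unrooted
  vertices are linked, so they form a single class.\<close>

lemma is_floating_component:
  assumes F: "\<And>e. e \<in> F \<Longrightarrow> e \<subseteq> V" and fl: "is_floating V S F"
  shows "C \<in> components (Graph V F) \<and> C \<inter> S = {} \<longleftrightarrow> C = unrooted V S F"
proof -
  have cls: "{b. linked F a b} = unrooted V S F" if a: "a \<in> unrooted V S F" for a
  proof (intro equalityI subsetI)
    fix b assume "b \<in> {b. linked F a b}"
    then have "linked F a b" by simp
    moreover have "b \<in> V" using linked_closed[OF \<open>linked F a b\<close> _ F] a by (auto simp: unrooted_def)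
    ultimately show "b \<in> unrooted V S F"
      using a linked_trans[of F a b] by (auto simp: unrooted_def)
  qed (use fl a in \<open>auto simp: is_floating_def\<close>)
  show ?thesis
  proof
    assume "C \<in> components (Graph V F) \<and> C \<inter> S = {}"
    then obtain a where "a \<in> V" "C = {b. linked F a b}" "C \<inter> S = {}"
      by (auto simp: components_eq[OF F])
    moreover from this have "a \<in> unrooted V S F" by (auto simp: unrooted_def)
    ultimately show "C = unrooted V S F" using cls by blast
  next
    assume C: "C = unrooted V S F"
    obtain a where a: "a \<in> unrooted V S F" using fl by (auto simp: is_floating_def)
    then have "a \<in> V" by (auto simp: unrooted_def)
    then have "{b. linked F a b} \<in> components (Graph V F)" by (simp add: components_eq[OF F])
    then have "C \<in> components (Graph V F)" by (simp only: C cls[OF a])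
    moreover have "C \<inter> S = {}" unfolding C using in_unrooted_not_root[of _ S V F] by auto
    ultimately show "C \<in> components (Graph V F) \<and> C \<inter> S = {}" by simp
  qed
qed

text \<open>All components but the floating one are classes of roots. Since there are
  \<open>card S + 1\<close> components, the map from roots to classes is injective, so no two roots
  are linked.\<close>

lemma is_floating_iff:
  assumes S: "finite S" "S \<subseteq> V" and F: "\<And>e. e \<in> F \<Longrightarrow> e \<subseteq> V"
  shows "card (components (Graph V F)) = card S + 1 \<and>
      (\<exists>!C. C \<in> components (Graph V F) \<and> C \<inter> S = {}) \<longleftrightarrow> is_floating V S F" (is "?l \<longleftrightarrow> ?r")
proof -
  let ?c = "\<lambda>a. {b. linked F a b}"
  let ?K = "components (Graph V F)"
  have split: "?K = insert C (?c ` S)" "C \<notin> ?c ` S"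
    if C: "C \<in> ?K" "C \<inter> S = {}" "\<And>D. D \<in> ?K \<Longrightarrow> D \<inter> S = {} \<Longrightarrow> D = C" for C
  proof -
    have "D \<in> ?c ` S" if D: "D \<in> ?K" "D \<noteq> C" for D
    proof -
      obtain a where a: "D = ?c a" using D by (auto simp: components_eq[OF F])
      obtain s where "s \<in> D" "s \<in> S" using C(3)[OF D(1)] D(2) by blast
      then show ?thesis using linked_class_eq_iff[of F a s] a by auto
    qed
    moreover have "?c ` S \<subseteq> ?K" using S(2) by (auto simp: components_eq[OF F])
    ultimately show "?K = insert C (?c ` S)" using C(1) by blast
    show "C \<notin> ?c ` S" using C(2) by auto
  qed
  show ?thesis
  proof
    assume l: ?l
    then obtain C where C: "C \<in> ?K" "C \<inter> S = {}" "\<And>D. D \<in> ?K \<Longrightarrow> D \<inter> S = {} \<Longrightarrow> D = C"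
      by metis
    have "card (?c ` S) = card S" using l split[OF C] S(1) by simp
    then have sep: "separates F S"
      using eq_card_imp_inj_on[OF S(1)] inj_on_linked_class by blast
    have cls: "?c x = C" if x: "x \<in> unrooted V S F" for x
      using C(3)[of "?c x"] x by (auto simp: unrooted_def components_eq[OF F])
    then have single: "linked F x y" if "x \<in> unrooted V S F" "y \<in> unrooted V S F" for x y
      using that linked_class_eq_iff[of F x y] by blast
    obtain a where "a \<in> V" "C = ?c a" using C(1) by (auto simp: components_eq[OF F])
    then have "a \<in> unrooted V S F" using C(2) by (auto simp: unrooted_def)
    then show ?r using sep single by (auto simp: is_floating_def)
  next
    assume r: ?r
    note iff = is_floating_component[OF F r]
    have ex1: "\<exists>!C. C \<in> ?K \<and> C \<inter> S = {}" by (simp add: iff)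
    have U: "unrooted V S F \<in> ?K \<and> unrooted V S F \<inter> S = {}" by (simp only: iff)
    have "D = unrooted V S F" if "D \<in> ?K" "D \<inter> S = {}" for D
      using that iff[of D] by simp
    note split[OF U[THEN conjunct1] U[THEN conjunct2] this]
    moreover have "card (?c ` S) = card S"
      using r by (intro card_image) (simp add: inj_on_linked_class is_floating_def)
    ultimately have "card ?K = card S + 1" using S(1) by simp
    with ex1 show ?l by simp
  qed
qed

section \<open>Forests of a tree as subsets of its edges\<close>

lemma spanning_forest_iff:
  assumes "is_tree T"
  shows "spanning_forest T G \<longleftrightarrow> (\<exists>F\<subseteq>edges T. G = Graph (verts T) F)"
proof
  assume "spanning_forest T G"
  then show "\<exists>F\<subseteq>edges T. G = Graph (verts T) F"
    by (intro exI[of _ "edges G"]) (auto simp: spanning_forest_def subgraph_def graph.expand)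
next
  assume "\<exists>F\<subseteq>edges T. G = Graph (verts T) F"
  then obtain F where F: "F \<subseteq> edges T" "G = Graph (verts T) F" by auto
  \<comment> \<open>Acyclicity is automatic: a cycle in a subset of the edges is a cycle of the
    tree.\<close>
  have "is_cycle T p" if "is_cycle G p" for p
    using that F by (auto simp: is_cycle_def elim!: successively_mono)
  then show "spanning_forest T G"
    using F assms by (auto simp: spanning_forest_def subgraph_def is_tree_def simple_graph_def acyclic_graph_def)
qed

lemma Collect_image_eq:
  "(\<And>F. F \<subseteq> E \<Longrightarrow> P (g F) \<longleftrightarrow> Q F) \<Longrightarrow>
    {G. (\<exists>F\<subseteq>E. G = g F) \<and> P G} = g ` {F \<in> Pow E. Q F}"
  by auto

context
  fixes T :: "'a graph" and S
  assumes T: "is_tree T" and S: "S \<subseteq> verts T"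
begin

lemma edge_subset_verts: "F \<subseteq> edges T \<Longrightarrow> e \<in> F \<Longrightarrow> e \<subseteq> verts T"
  using T by (auto simp: is_tree_def simple_graph_def)

lemma finite_tree: "finite (verts T)" "finite S" "finite (edges T)"
proof -
  show "finite (verts T)" using T by (auto simp: is_tree_def simple_graph_def)
  then show "finite S" using S finite_subset by auto
  show "finite (edges T)"
    using \<open>finite (verts T)\<close> edge_subset_verts[of "edges T"] finite_subset[of "edges T" "Pow (verts T)"]
    by auto
qed

lemma rooted_forests_eq:
  "\<F>\<^sub>1 T S = Graph (verts T) ` {F \<in> Pow (edges T). is_rooted (verts T) S F}"
  unfolding rooted_forests_def spanning_forest_iff[OF T]
  by (intro Collect_image_eq is_rooted_iff[OF finite_tree(2) S edge_subset_verts])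

lemma floating_forests_eq:
  "\<F>\<^sub>2 T S = Graph (verts T) ` {F \<in> Pow (edges T). is_floating (verts T) S F}"
  unfolding floating_forests_def spanning_forest_iff[OF T]
  by (intro Collect_image_eq is_floating_iff[OF finite_tree(2) S edge_subset_verts])

lemma floating_component_eq:
  assumes "F \<subseteq> edges T" "is_floating (verts T) S F"
  shows "floating_component S (Graph (verts T) F) = unrooted (verts T) S F"
  unfolding floating_component_def
  using is_floating_component[OF edge_subset_verts[OF assms(1)] assms(2)] by simp

lemma card_rooted_forests: "int (card (\<F>\<^sub>1 T S)) = num_rooted (verts T) (edges T) S"
proof -
  have "card (\<F>\<^sub>1 T S) = card {F \<in> Pow (edges T). is_rooted (verts T) S F}"
    unfolding rooted_forests_eq by (rule card_image) (simp add: inj_on_def)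
  also have "int \<dots> = (\<Sum>F\<in>Pow (edges T). if is_rooted (verts T) S F then 1 else 0)"
    using finite_tree(3) by (subst sum.inter_filter[symmetric]) auto
  finally show ?thesis by (simp add: num_rooted_def of_bool_def)
qed

lemma forest_sum_eq:
  "(int (card S) - 1) * int (card (\<F>\<^sub>1 T S)) -
    (\<Sum>F\<in>\<F>\<^sub>2 T S. (int (\<delta> T (floating_component S F)) - 1) *
                      (int (\<delta> T (floating_component S F)) - 4)) =
   forest_sum (verts T) (edges T) S"
proof -
  let ?q = "\<lambda>k. (int k - 1) * (int k - 4)"
  have "(\<Sum>F\<in>\<F>\<^sub>2 T S. ?q (\<delta> T (floating_component S F))) =
    (\<Sum>F\<in>{F \<in> Pow (edges T). is_floating (verts T) S F}.
      ?q (\<delta> T (floating_component S (Graph (verts T) F))))"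
    unfolding floating_forests_eq by (subst sum.reindex) (auto simp: inj_on_def)
  also have "\<dots> = (\<Sum>F\<in>{F \<in> Pow (edges T). is_floating (verts T) S F}. ?q (\<delta> T (unrooted (verts T) S F)))"
    by (intro sum.cong) (auto simp: floating_component_eq)
  also have "\<dots> = (\<Sum>F\<in>Pow (edges T). if is_floating (verts T) S F
      then ?q (\<delta> T (unrooted (verts T) S F)) else 0)"
    using finite_tree(3) by (subst sum.inter_filter[symmetric]) auto
  finally show ?thesis unfolding forest_sum_def card_rooted_forests graph.collapse by simp
qed

lemma det_dist_mat:
  assumes xs: "distinct xs" "set xs = S" "xs \<noteq> []"
  shows "4 * det (dist_mat (\<lambda>a b. int (tree_dist T a b)) xs) =
    - ((- 2) ^ length xs) * forest_sum (verts T) (edges T) S"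
proof -
  let ?V = "verts T" and ?E = "edges T"
  let ?d = "int_dist ?V ?E" and ?A = "num_rooted ?V ?E S"
  let ?\<mu> = "\<lambda>s. floating_weight ?V ?E (S - {s}) s"
  have bt: "built_tree ?V ?E" by (rule built_tree_if_is_tree[OF T])
  have xsV: "set xs \<subseteq> ?V" using xs S by simp
  note ids = built_tree_forest_identities[OF bt, unfolded forest_identities_def, rule_format, OF S]
  have sum_nth: "(\<Sum>i<length xs. g (xs ! i)) = (\<Sum>s\<in>S. g s)" for g :: "'a \<Rightarrow> int"
    using sum.reindex_bij_betw[OF bij_betw_nth[OF xs(1) refl xs(2)[symmetric]], of g] by simp
  \<comment> \<open>The identities are quantified over vertices \<open>t\<close> and
    \<open>w\<close>, so even one that mentions neither needs some vertex as an instance.\<close>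
  have "xs ! 0 \<in> ?V" using xsV xs(3) by (simp add: subset_eq)
  then have "(\<Sum>s\<in>S. ?\<mu> s) = 2 * ?A" using ids by blast
  then have total: "(\<Sum>i<length xs. ?\<mu> (xs ! i)) = 2 * ?A" using sum_nth[of ?\<mu>] by simp
  have row: "(\<Sum>j<length xs. ?d (xs ! i) (xs ! j) * ?\<mu> (xs ! j)) = forest_sum ?V ?E S"
    if "i < length xs" for i
  proof -
    have i: "xs ! i \<in> S" using that xs(2) nth_mem by blast
    then have "xs ! i \<in> ?V" using S by auto
    then have "(\<Sum>s\<in>S. ?d (xs ! i) s * ?\<mu> s) = forest_sum ?V ?E S + 2 * floating_weight ?V ?E S (xs ! i)"
      using ids by blast
    \<comment> \<open>At a root the correction \<open>2 * floating_weight\<close> vanishes, so every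
      row has the same value.\<close>
    then show ?thesis
      using i floating_weight_eq_0[of "xs ! i" S] sum_nth[of "\<lambda>s. ?d (xs ! i) s * ?\<mu> s"] by simp
  qed
  have cramer: "- forest_sum ?V ?E S * det (bordered_mat ?d xs) = 2 * ?A * det (dist_mat ?d xs)"
    by (rule det_bordered_cramer[where \<mu> = "\<lambda>i. ?\<mu> (xs ! i)" and d = ?d and xs = xs, OF total row])
  have "2 * det (bordered_mat ?d xs) = (- 2) ^ length xs * ?A"
    using det_bordered_eq_num_rooted[OF bt xs(1) xsV] xs(2) by simp
  \<comment> \<open>Twice the Cramer relation with the value of the bordered determinant inserted;
    both sides now contain the nonzero factor \<open>?A\<close>.\<close>
  then have "- forest_sum ?V ?E S * ((- 2) ^ length xs * ?A) = 2 * (2 * ?A * det (dist_mat ?d xs))"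
    using cramer by (metis mult.left_commute)
  then have "?A * (4 * det (dist_mat ?d xs)) = ?A * (- ((- 2) ^ length xs) * forest_sum ?V ?E S)"
    by (simp add: algebra_simps)
  moreover have "?A \<noteq> 0"
    using built_tree_num_rooted_pos[OF bt S] xs by auto
  ultimately have "4 * det (dist_mat ?d xs) = - ((- 2) ^ length xs) * forest_sum ?V ?E S"
    by (simp only: mult_left_cancel[OF \<open>?A \<noteq> 0\<close>])
  moreover have "Graph ?V ?E = T" by (cases T) simp
  ultimately show ?thesis by simp
qed

end

section \<open>The principal submatrix and the determinant formula\<close>

lemma principal_submatrix_distance_matrix:
  assumes "S \<subseteq> {1..n}"
  obtains xs where "distinct xs" "set xs = S"
    "principal_submatrix (distance_matrix n T) S = dist_mat (\<lambda>a b. int (tree_dist T a b)) xs"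
proof -
  \<comment> \<open>\<open>S\<close> shifted to matrix indices starting at \<open>0\<close>; nothing
    is lost, as \<open>0 \<notin> S\<close>.\<close>
  define I where "I = {i. Suc i \<in> S}"
  have SucI: "Suc ` I = S"
  proof -
    have "s \<in> Suc ` I" if "s \<in> S" for s
      using that assms by (cases s) (auto simp: I_def)
    then show ?thesis by (auto simp: I_def)
  qed
  then have card: "card I = card S" by (metis card_image inj_Suc inj_on_subset subset_UNIV)
  have less: "i < n" if "i \<in> I" for i using that assms by (auto simp: I_def)
  then have "{i. i < n \<and> i \<in> I} = I" by auto
  \<comment> \<open>\<open>pick I\<close> enumerates \<open>I\<close> increasingly, exactly as
    \<open>submatrix\<close> does, so \<open>xs\<close> lists \<open>S\<close> in the order of the
    rows.\<close>
  define xs where "xs = map (\<lambda>i. Suc (pick I i)) [0..<card S]"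
  have pick: "pick I i \<in> I" if "i < card S" for i
    using that pick_in_set_le card by simp
  have "inj_on (pick I) {0..<card S}"
  proof (rule linorder_inj_onI)
    fix i j assume "i < j" "i \<in> {0..<card S}" "j \<in> {0..<card S}"
    then show "pick I i \<noteq> pick I j" using pick_mono[of j I i] card by auto
  qed auto
  then have dist: "distinct xs" by (auto simp: xs_def distinct_map inj_on_def)
  have sub: "set xs \<subseteq> S" using pick by (auto simp: xs_def I_def)
  have "finite S" using assms finite_subset by auto
  moreover have "length xs = card S" by (simp add: xs_def)
  then have "card (set xs) = card S" using distinct_card[OF dist] by simp
  ultimately have "set xs = S" using sub card_subset_eq by blast
  moreover have "principal_submatrix (distance_matrix n T) S = dist_mat (\<lambda>a b. int (tree_dist T a b)) xs"
    using pick less \<open>{i. i < n \<and> i \<in> I} = I\<close> card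
    unfolding principal_submatrix_def submatrix_def I_def[symmetric] dist_mat_def distance_matrix_def
    by (intro eq_matI) (auto simp: xs_def)
  ultimately show ?thesis using that dist by blast
qed

theorem theoremA:
  fixes n m :: nat and T :: "nat graph" and S :: "nat set"
  assumes "is_tree T" and "verts T = {1..n}"
    and "S \<subseteq> {1..n}" and "card S = m" and "m \<ge> 2"
  shows "det (principal_submatrix (distance_matrix n T) S) =
    (-1) ^ (m - 1) * 2 ^ (m - 2) *
      ((int m - 1) * int (card (\<F>\<^sub>1 T S)) -
       (\<Sum>F\<in>\<F>\<^sub>2 T S. (int (\<delta> T (floating_component S F)) - 1) *
                         (int (\<delta> T (floating_component S F)) - 4)))"
proof -
  obtain xs where xs: "distinct xs" "set xs = S"
    and sub: "principal_submatrix (distance_matrix n T) S = dist_mat (\<lambda>a b. int (tree_dist T a b)) xs"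
    using principal_submatrix_distance_matrix[OF assms(3)] by blast
  have S: "S \<subseteq> verts T" using assms by simp
  have len: "length xs = m" using xs assms(4) distinct_card by metis
  then have "xs \<noteq> []" using assms(5) by auto
  note det = det_dist_mat[OF assms(1) S xs this, unfolded len]
  \<comment> \<open>With \<open>m = k + 2\<close>, \<open>- ((- 2) ^ m)\<close> equals
    \<open>4 * (- 1) ^ (m - 1) * 2 ^ (m - 2)\<close>, so the factor \<open>4\<close> cancels and no
    truncated exponent remains.\<close>
  obtain k where k: "m = Suc (Suc k)" using assms(5) by (metis Suc_le_D numeral_2_eq_2 Suc_le_mono)
  have "det (principal_submatrix (distance_matrix n T) S) =
    (- 1) ^ (m - 1) * 2 ^ (m - 2) * forest_sum (verts T) (edges T) S"
    using det unfolding sub k by (simp add: power_minus[of 2])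
  then show ?thesis
    unfolding forest_sum_eq[OF assms(1) S, symmetric] assms(4) .
qed

end
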